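(* Let $d\ge1$ be an integer, let $\delta\in(0,1)$, $z\in[0,\mu^{-1})$, and $x\in\mathbb{Z}^d$. For $g>0$ and $\rho\in\mathbb{R}$ let $\alpha(g,\rho)=\tfrac12 g^{-1/2}(\rho-1)$. Suppose that $\rho=\rho(g)$ is chosen in such a way that $$\lim_{g\to\infty}g^{-1/2}e^{\alpha(g,\rho(g))^2}=p,$$ where $p\in[0,\infty)$ is the value specified by $z$ via $z=(2d)^{-1}(1-\delta)p\sqrt{\pi}$. Then $$\lim_{g\to\infty}G^{\rm CT}_{g,\rho(g)}(x)=p\sqrt{\pi}\,G_z(x).$$
   Context: Self-avoiding walks: $c_n$ is the number of $n$-step nearest-neighbour self-avoiding walks in $\mathbb{Z}^d$ started at $0$, i.e. sequences $(Y_0,\dots,Y_n)$ of distinct points of $\mathbb{Z}^d$ with $Y_0=0$ and $|Y_{i+1}-Y_i|=1$ (Euclidean distance); $c_n(x)$ is the number of these with $Y_n=x$. $\mu=\lim_{n\to\infty}c_n^{1/n}$ (this limit exists by subadditivity). The two-point function of the strictly self-avoiding walk is $G_z(x)=\sum_{n=0}^\infty c_n(x)z^n$. Continuous-time weakly self-avoiding walk: fix $\delta\in(0,1)$. $X=X(t)$ is the continuous-time Markov process with state space $\mathbb{Z}^d\cup\{\partial\}$, started at $0$, where $\partial$ is an absorbing state (the cemetery). When $X$ arrives at a state $x\in\mathbb{Z}^d$, it waits for an $\mathrm{Exp}(1)$ holding time and then jumps to each given neighbour of $x$ with probability $(2d)^{-1}(1-\delta)$ and to $\partial$ with probability $\delta$;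 the holding times are independent of each other and of the jumps. $\mathbb{E}^{(\delta)}$ denotes expectation for this process, $\zeta$ is the time at which $X$ jumps to $\partial$, $X(\zeta^-)$ is the last site of $\mathbb{Z}^d$ occupied before that jump, and $L_v=\int_0^\zeta\mathbf{1}_{X(s)=v}\,ds$ is the local time at $v\in\mathbb{Z}^d$. For $g>0$ and $x\in\mathbb{Z}^d$, and for any real $\rho$ for which the expectation is finite, $$G^{\rm CT}_{g,\rho}(x)=\frac1\delta\,\mathbb{E}^{(\delta)}\Big(e^{-g\sum_{v\in\mathbb{Z}^d}L_v^2+\rho\zeta}\,\mathbf{1}_{X(\zeta^-)=x}\Big)$$ (the dependence on $\delta$ is left implicit).
   Formalization: When p>0 the formal theorem also assumes α(g,ρ(g))≥0 for all large g; without it the claim fails, since with α→−∞ the same limit p is possible but the two-point function tends to 0. *)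

theory Defs
  imports "HOL-Probability.Probability"
begin

section \<open>Self-avoiding walks on the integer lattice\<close>

text \<open>The lattice of dimension \<open>d\<close> is the type \<^typ>\<open>int ^ 'd\<close> with \<open>d = CARD('d)\<close>.\<close>

definition adjacent :: "int ^ 'd \<Rightarrow> int ^ 'd \<Rightarrow> bool" where
  "adjacent x y \<longleftrightarrow> norm (\<chi> i. real_of_int (y $ i - x $ i)) = 1"

text \<open>A walk with \<open>n\<close> steps is the list of its \<open>n + 1\<close> sites.\<close>

definition saws :: "nat \<Rightarrow> (int ^ 'd) list set" where
  "saws n = {ys. length ys = Suc n \<and> hd ys = 0 \<and> distinct ys \<and>
                 (\<forall>i<n. adjacent (ys ! i) (ys ! Suc i))}"

definition saw_count :: "'d::finite itself \<Rightarrow> nat \<Rightarrow> nat" where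
  "saw_count _ n = card (saws n :: (int ^ 'd) list set)"

definition saw_count_to :: "nat \<Rightarrow> int ^ 'd \<Rightarrow> nat" where
  "saw_count_to n x = card {ys \<in> saws n. last ys = x}"

definition connective_constant :: "'d::finite itself \<Rightarrow> real" where
  "connective_constant T = lim (\<lambda>n. root n (real (saw_count T n)))"

definition saw_two_point :: "real \<Rightarrow> int ^ 'd \<Rightarrow> real" where
  "saw_two_point z x = (\<Sum>n. real (saw_count_to n x) * z ^ n)"

section \<open>Continuous-time walk with killing\<close>

text \<open>The state space is \<^typ>\<open>(int ^ 'd) option\<close>, with \<^term>\<open>None\<close> as the cemetery.\<close>

definition jump_prob :: "real \<Rightarrow> (int ^ 'd) option \<Rightarrow> (int ^ 'd) option \<Rightarrow> real" where
  "jump_prob \<delta> a b =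
     (case a of
        None \<Rightarrow> (if b = None then 1 else 0)
      | Some x \<Rightarrow> (case b of
          None \<Rightarrow> \<delta>
        | Some y \<Rightarrow> (if adjacent x y then (1 - \<delta>) / (2 * real CARD('d)) else 0)))"

definition jump_chain :: "real \<Rightarrow> 'w measure \<Rightarrow> (nat \<Rightarrow> 'w \<Rightarrow> (int ^ 'd) option) \<Rightarrow> bool" where
  "jump_chain \<delta> M Y \<longleftrightarrow>
     (\<forall>n. Y n \<in> measurable M (count_space UNIV)) \<and>
     (\<forall>n y. measure M {\<omega> \<in> space M. \<forall>i\<le>n. Y i \<omega> = y i} =
        (if y 0 = Some 0 then \<Prod>i<n. jump_prob \<delta> (y i) (y (Suc i)) else 0))"

definition holding_times :: "'w measure \<Rightarrow> (nat \<Rightarrow> 'w \<Rightarrow> real) \<Rightarrow> bool" where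
  "holding_times M \<sigma> \<longleftrightarrow>
     (\<forall>n. distributed M lborel (\<sigma> n) (exponential_density 1)) \<and>
     prob_space.indep_vars M (\<lambda>_. borel) \<sigma> UNIV"

text \<open>
  \<open>X\<close> occupies the \<open>n\<close>-th state \<open>Y n\<close> of its jump chain for the time \<open>\<sigma> n\<close>.  The chain also
  makes (trivial) jumps from the cemetery to itself; these only subdivide the time that \<open>X\<close>
  spends there, and they ensure that almost surely the intervals below cover the half-line.
\<close>

definition killed_walk :: "real \<Rightarrow> 'w measure \<Rightarrow> (real \<Rightarrow> 'w \<Rightarrow> (int ^ 'd) option) \<Rightarrow> bool" where
  "killed_walk \<delta> M X \<longleftrightarrow>
     prob_space M \<and>
     (\<forall>t\<ge>0. X t \<in> measurable M (count_space UNIV)) \<and>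
     (\<exists>Y \<sigma>. jump_chain \<delta> M Y \<and> holding_times M \<sigma> \<and>
        prob_space.indep_set M
          (sets (vimage_algebra (space M) (\<lambda>\<omega> n. Y n \<omega>) (Pi\<^sub>M UNIV (\<lambda>_. count_space UNIV))))
          (sets (vimage_algebra (space M) (\<lambda>\<omega> n. \<sigma> n \<omega>) (Pi\<^sub>M UNIV (\<lambda>_. borel)))) \<and>
        (AE \<omega> in M. \<forall>n t. (\<Sum>i<n. \<sigma> i \<omega>) \<le> t \<and> t < (\<Sum>i<Suc n. \<sigma> i \<omega>) \<longrightarrow> X t \<omega> = Y n \<omega>))"

text \<open>
  The next three notions depend on a path \<open>\<xi> = (\<lambda>t. X t \<omega>)\<close>.  The left limit
  \<open>X(\<zeta>-)\<close> is taken in the discrete topology.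
\<close>

definition killing_time :: "(real \<Rightarrow> 'a option) \<Rightarrow> real" where
  "killing_time \<xi> = Inf {t. 0 \<le> t \<and> \<xi> t = None}"

definition last_site :: "(real \<Rightarrow> 'a option) \<Rightarrow> 'a \<Rightarrow> bool" where
  "last_site \<xi> x \<longleftrightarrow> (\<forall>\<^sub>F t in at_left (killing_time \<xi>). \<xi> t = Some x)"

definition local_time :: "(real \<Rightarrow> 'a option) \<Rightarrow> 'a \<Rightarrow> real" where
  "local_time \<xi> v = (LBINT s:{0..killing_time \<xi>}. of_bool (\<xi> s = Some v))"

text \<open>
  The expectation of the nonnegative random variable is taken in \<open>[0, \<infinity>]\<close>, so that it is
  meaningful for all \<open>g\<close> and \<open>\<rho>\<close>.
\<close>

definition ct_two_point ::
    "real \<Rightarrow> 'w measure \<Rightarrow> (real \<Rightarrow> 'w \<Rightarrow> (int ^ 'd) option) \<Rightarrow> real \<Rightarrow> real \<Rightarrow> int ^ 'd \<Rightarrow> ennreal" where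
  "ct_two_point \<delta> M X g \<rho> x =
     ennreal (1 / \<delta>) *
     (\<integral>\<^sup>+ \<omega>. (let \<xi> = (\<lambda>t. X t \<omega>) in
        ennreal (exp (- g * (\<Sum>\<^sub>\<infinity>v\<in>UNIV. (local_time \<xi> v)\<^sup>2) + \<rho> * killing_time \<xi>)
                 * of_bool (last_site \<xi> x))) \<partial>M)"

text \<open>
  Completing the square, \<open>\<integral>\<^sub>0\<^sup>\<infinity> exp (- g l\<^sup>2 + (\<rho> - 1) l) dl = g powr (- 1/2) * exp (\<alpha>\<^sup>2) * \<integral> exp (- t\<^sup>2) dt\<close>
  with \<open>t\<close> from \<open>- \<alpha>\<close> to \<open>\<infinity>\<close>.  A limit \<open>p > 0\<close> of \<open>g powr (- 1/2) * exp (\<alpha>\<^sup>2)\<close> leaves the sign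
  of \<open>\<alpha>\<close> undetermined, and the integral tends to \<open>p * sqrt pi\<close> only if \<open>\<alpha>\<close> is eventually
  nonnegative (for \<open>\<alpha> \<rightarrow> -\<infinity>\<close> it tends to \<open>0\<close>).
\<close>

definition alpha :: "real \<Rightarrow> real \<Rightarrow> real" where
  "alpha g \<rho> = 1 / 2 * g powr (- 1 / 2) * (\<rho> - 1)"

end

theory Submission
  imports Defs
begin

text \<open>
  Expanding over the trajectory of the jump chain, the two-point function is
  \<open>\<Sum>\<^sub>n c\<^sup>n \<Sum>\<^sub>Y W(Y)\<close> with \<open>c = (1 - \<delta>) / (2 d)\<close>, where \<open>Y\<close> runs over the \<open>n\<close>-step walks to \<open>x\<close> and \<open>W(Y)\<close>
  integrates the interaction over the holding times.  If \<open>Y\<close> is self-avoiding, \<open>W(Y)\<close> is the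
  \<open>n + 1\<close>st power of a Gaussian integral that tends to \<open>p \<surd>\<pi>\<close>; if \<open>Y\<close> visits a site twice, \<open>W(Y)\<close>
  tends to \<open>0\<close>.  Since \<open>c p \<surd>\<pi> = z\<close>, the limit is formally \<open>p \<surd>\<pi> G\<^sub>z(x)\<close>.  Submultiplicativity of \<open>W\<close>
  under concatenation and \<open>z < 1 / \<mu>\<close> give a geometric bound on the \<open>n\<close>th term that is uniform in
  large \<open>g\<close>, so Tannery's theorem justifies the exchange of limit and sum.
\<close>

section \<open>Gaussian integrals over one holding time\<close>

text \<open>The obstacle is domination. Bounding every weight by the power of the Gaussian integral
  forgets the repulsion altogether and compares the n-th term with a multiple of (2 d z)^n, while z
  < 1/\<mu> permits 2 d z \<ge> 1. Self-avoidance thus has to act before the sum over n is taken,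
  although for each finite g it holds only approximately. The remedy is to use the limit of large g
  at one fixed block length, where finitely many walks occur, and to carry the gain over to all
  lengths by submultiplicativity. For this the weight of a walk is built by feeding in the holding
  times one at a time, with the field of accumulated local times as a parameter. Repulsion then is
  monotonicity in this field, and interactions are dropped by resetting the field to 0.\<close>

abbreviation Exp1 :: "real measure" where
  "Exp1 \<equiv> density lborel (exponential_density 1)"

text \<open>The factor contributed by a further holding time \<open>s\<close> at a site that already
  carries local time \<open>a\<close>. The density exp(-s) is left to \<open>Exp1\<close>; this is
  why \<rho> appears here but \<rho> - 1 in \<open>alpha\<close>.\<close>

definition site_weight :: "real \<Rightarrow> real \<Rightarrow> real \<Rightarrow> real \<Rightarrow> real" where
  "site_weight g \<rho> a s = exp (- g * (s\<^sup>2 + 2 * a * s) + \<rho> * s)"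

definition site_integral :: "real \<Rightarrow> real \<Rightarrow> real \<Rightarrow> ennreal" where
  "site_integral g \<rho> a = (\<integral>\<^sup>+ s. ennreal (site_weight g \<rho> a s) \<partial>Exp1)"

text \<open>The integral of exp(-g s^2 + (\<rho> - 1) s) over the whole real line.\<close>

definition gauss_mass :: "real \<Rightarrow> real \<Rightarrow> real" where
  "gauss_mass g \<rho> = sqrt pi * (g powr (- 1 / 2) * exp ((alpha g \<rho>)\<^sup>2))"

interpretation Exp1: prob_space Exp1
  by (rule prob_space_exponential_density) simp

lemma site_weight_pos: "0 < site_weight g \<rho> a s"
  by (simp add: site_weight_def)

lemma site_weight_measurable [measurable]:
  assumes [measurable]: "f \<in> borel_measurable N" "h \<in> borel_measurable N"
  shows "(\<lambda>x. site_weight g \<rho> (f x) (h x)) \<in> borel_measurable N"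
  unfolding site_weight_def by measurable

lemma AE_Exp1_nonneg: "AE s in Exp1. 0 \<le> s"
  by (subst AE_density) (auto simp: exponential_density_def)

lemma site_weight_antimono:
  assumes "0 \<le> g" "a \<le> b" "0 \<le> s"
  shows "site_weight g \<rho> b s \<le> site_weight g \<rho> a s"
proof -
  have "g * (s\<^sup>2 + 2 * a * s) \<le> g * (s\<^sup>2 + 2 * b * s)"
    using assms by (intro mult_left_mono add_left_mono mult_right_mono) auto
  then show ?thesis by (simp add: site_weight_def)
qed

lemma site_integral_antimono:
  assumes "0 \<le> g" "a \<le> b"
  shows "site_integral g \<rho> b \<le> site_integral g \<rho> a"
  unfolding site_integral_def
  by (intro nn_integral_mono_AE eventually_mono[OF AE_Exp1_nonneg])
     (use assms in \<open>auto intro!: ennreal_leI site_weight_antimono\<close>)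

lemma alpha_sq:
  assumes "0 < g"
  shows "(alpha g \<rho>)\<^sup>2 = (\<rho> - 1)\<^sup>2 / (4 * g)"
proof -
  have "(g powr (- 1 / 2))\<^sup>2 = 1 / g"
    using assms by (simp add: powr_half_sqrt powr_minus_divide power_divide)
  then show ?thesis
    unfolding alpha_def power_mult_distrib by (simp add: power2_eq_square)
qed

text \<open>Completing the square, with exp(-s) absorbed into the linear term. Integrals over one
  holding time thereby become statements about a normal law restricted to the half-line.\<close>

lemma site_weight_eq_normal_density:
  assumes "0 < g"
  shows "exp (- s) * site_weight g \<rho> 0 s
    = gauss_mass g \<rho> * normal_density ((\<rho> - 1) / (2 * g)) (1 / sqrt (2 * g)) s"
proof -
  define m where "m = (\<rho> - 1) / (2 * g)"
  have "(\<rho> - 1)\<^sup>2 / (4 * g) = g * m\<^sup>2"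
    using assms by (simp add: m_def power2_eq_square)
  moreover have "\<rho> = 2 * g * m + 1"
    using assms by (simp add: m_def)
  ultimately have 1: "- s + (- g * (s\<^sup>2 + 2 * 0 * s) + \<rho> * s)
      = (alpha g \<rho>)\<^sup>2 + - (s - m)\<^sup>2 / (2 * (1 / sqrt (2 * g))\<^sup>2)"
    using assms by (simp add: alpha_sq power_divide) (simp add: power2_eq_square algebra_simps)
  have 2: "sqrt pi * g powr (- 1 / 2) * (1 / sqrt (2 * pi * (1 / sqrt (2 * g))\<^sup>2)) = 1"
    using assms by (simp add: powr_half_sqrt powr_minus_divide power_divide real_sqrt_divide)
  have "exp (- s) * site_weight g \<rho> 0 s = exp (- s + (- g * (s\<^sup>2 + 2 * 0 * s) + \<rho> * s))"
    unfolding site_weight_def by (simp only: exp_add)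
  also have "\<dots> = (sqrt pi * g powr (- 1 / 2) * (1 / sqrt (2 * pi * (1 / sqrt (2 * g))\<^sup>2)))
     * (exp ((alpha g \<rho>)\<^sup>2) * exp (- (s - m)\<^sup>2 / (2 * (1 / sqrt (2 * g))\<^sup>2)))"
    unfolding 1 2 by (simp only: exp_add mult_1_left)
  finally show ?thesis
    unfolding gauss_mass_def normal_density_def m_def by (simp add: mult_ac)
qed

lemma gauss_mass_nonneg: "0 \<le> gauss_mass g \<rho>"
  by (simp add: gauss_mass_def)

lemma nn_integral_site_weight:
  assumes "0 < g" and [measurable]: "f \<in> borel_measurable borel"
  shows "(\<integral>\<^sup>+ s. ennreal (site_weight g \<rho> 0 s) * f s \<partial>Exp1)
    = ennreal (gauss_mass g \<rho>) *
      (\<integral>\<^sup>+ s. f s * indicator {0..} s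
         \<partial>density lborel (normal_density ((\<rho> - 1) / (2 * g)) (1 / sqrt (2 * g))))"
proof -
  let ?n = "normal_density ((\<rho> - 1) / (2 * g)) (1 / sqrt (2 * g))"
  have "(\<integral>\<^sup>+ s. ennreal (site_weight g \<rho> 0 s) * f s \<partial>Exp1)
      = (\<integral>\<^sup>+ s. ennreal (exponential_density 1 s) * (ennreal (site_weight g \<rho> 0 s) * f s) \<partial>lborel)"
    by (subst nn_integral_density) auto
  also have "\<dots> = (\<integral>\<^sup>+ s. ennreal (gauss_mass g \<rho>) * (ennreal (?n s) * (f s * indicator {0..} s)) \<partial>lborel)"
  proof (intro nn_integral_cong)
    fix s :: real
    show "ennreal (exponential_density 1 s) * (ennreal (site_weight g \<rho> 0 s) * f s)
       = ennreal (gauss_mass g \<rho>) * (ennreal (?n s) * (f s * indicator {0..} s))"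
      using site_weight_eq_normal_density[OF assms(1), of s \<rho>] site_weight_pos[of g \<rho> 0 s]
      by (cases "s < 0")
         (auto simp: exponential_density_def mult.assoc[symmetric] ennreal_mult'[symmetric]
           ennreal_mult''[symmetric])
  qed
  also have "\<dots> = ennreal (gauss_mass g \<rho>) * (\<integral>\<^sup>+ s. ennreal (?n s) * (f s * indicator {0..} s) \<partial>lborel)"
    by (rule nn_integral_cmult) auto
  also have "(\<integral>\<^sup>+ s. ennreal (?n s) * (f s * indicator {0..} s) \<partial>lborel)
     = (\<integral>\<^sup>+ s. f s * indicator {0..} s \<partial>density lborel ?n)"
    by (subst nn_integral_density) auto
  finally show ?thesis .
qed

text \<open>The half-line has normal probability at most 1. This estimate is valid for both signs of
  \<alpha>, and it alone settles the case p = 0 later.\<close>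

lemma site_integral_le:
  assumes "0 < g"
  shows "site_integral g \<rho> 0 \<le> ennreal (gauss_mass g \<rho>)"
proof -
  interpret N: prob_space "density lborel (normal_density ((\<rho> - 1) / (2 * g)) (1 / sqrt (2 * g)))"
    using assms by (intro prob_space_normal_density) simp
  have "site_integral g \<rho> 0 = (\<integral>\<^sup>+ s. ennreal (site_weight g \<rho> 0 s) * 1 \<partial>Exp1)"
    by (simp add: site_integral_def)
  also have "\<dots> \<le> ennreal (gauss_mass g \<rho>) * 1"
    unfolding nn_integral_site_weight[OF assms borel_measurable_const]
    using N.measure_le_1 by (intro mult_left_mono) (auto intro!: N.emeasure_le_1)
  finally show ?thesis by simp
qed

text \<open>Chebyshev's inequality with variance 1/(2g) and deviation m/2. A polynomial tail
  suffices, since g m^2 will be \<alpha>^2, which diverges when p > 0.\<close>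

lemma normal_lower_tail:
  assumes g: "0 < g" and m: "0 < m"
  shows "emeasure (density lborel (normal_density m (1 / sqrt (2 * g)))) {..< m / 2}
    \<le> ennreal (2 / (g * m\<^sup>2))"
proof -
  let ?n = "normal_density m (1 / sqrt (2 * g))"
  have pos: "0 < 1 / sqrt (2 * g)" using g by simp
  have "has_bochner_integral lborel (\<lambda>x. ?n x * (x - m) ^ (2 * 1)) (1 / (2 * g))"
    using normal_moment_even[OF pos, of m 1] g by (simp add: power_divide)
  then have hb: "has_bochner_integral lborel (\<lambda>x. ?n x * (x - m)\<^sup>2 * (4 / m\<^sup>2)) (1 / (2 * g) * (4 / m\<^sup>2))"
    by (intro has_bochner_integral_mult_left) simp
  have "emeasure (density lborel ?n) {..< m / 2} = (\<integral>\<^sup>+ x. ennreal (?n x) * indicator {..< m / 2} x \<partial>lborel)"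
    by (subst emeasure_density) auto
  also have "\<dots> \<le> (\<integral>\<^sup>+ x. ennreal (?n x * (x - m)\<^sup>2 * (4 / m\<^sup>2)) \<partial>lborel)"
  proof (intro nn_integral_mono)
    fix x :: real
    show "ennreal (?n x) * indicator {..< m / 2} x \<le> ennreal (?n x * (x - m)\<^sup>2 * (4 / m\<^sup>2))"
    proof (cases "x < m / 2")
      case True
      then have "(m / 2)\<^sup>2 \<le> (m - x)\<^sup>2" using m by (intro power_mono) auto
      then have "1 \<le> (x - m)\<^sup>2 * (4 / m\<^sup>2)"
        using m by (simp add: power_divide power2_commute field_simps)
      then have "?n x * 1 \<le> ?n x * ((x - m)\<^sup>2 * (4 / m\<^sup>2))"
        by (intro mult_left_mono) auto
      then show ?thesis using True by (simp add: mult.assoc)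
    qed simp
  qed
  also have "\<dots> = ennreal (1 / (2 * g) * (4 / m\<^sup>2))"
    using hb by (subst nn_integral_eq_integral)
      (auto simp: has_bochner_integral_iff intro!: AE_I2)
  finally show ?thesis by (simp add: field_simps)
qed

text \<open>The mean of the tilted law is \<alpha>/sqrt g and its standard deviation 1/sqrt(2g), so
  its relative fluctuation depends on \<alpha> alone and is of order 1/\<alpha>.\<close>

lemma alpha_pos_mean:
  assumes "0 < g" "0 < alpha g \<rho>"
  shows "0 < (\<rho> - 1) / (2 * g)" "g * ((\<rho> - 1) / (2 * g))\<^sup>2 = (alpha g \<rho>)\<^sup>2"
  using assms alpha_sq[of g \<rho>] by (auto simp: alpha_def zero_less_mult_iff power2_eq_square)

lemma site_weight_lower_tail:
  assumes g: "0 < g" and a: "0 < alpha g \<rho>"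
  shows "(\<integral>\<^sup>+ s. ennreal (site_weight g \<rho> 0 s) * indicator {..< (\<rho> - 1) / (2 * g) / 2} s \<partial>Exp1)
     \<le> ennreal (gauss_mass g \<rho> * (2 / (alpha g \<rho>)\<^sup>2))"
proof -
  let ?m = "(\<rho> - 1) / (2 * g)"
  let ?N = "density lborel (normal_density ?m (1 / sqrt (2 * g)))"
  have "(\<integral>\<^sup>+ s. ennreal (site_weight g \<rho> 0 s) * indicator {..< ?m / 2} s \<partial>Exp1)
      \<le> ennreal (gauss_mass g \<rho>) * emeasure ?N {..< ?m / 2}"
    unfolding nn_integral_site_weight[OF g borel_measurable_indicator[OF lessThan_borel]]
    by (subst nn_integral_indicator[symmetric], simp)
       (intro mult_left_mono nn_integral_mono, auto split: split_indicator)
  also have "\<dots> \<le> ennreal (gauss_mass g \<rho>) * ennreal (2 / (alpha g \<rho>)\<^sup>2)"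
    using normal_lower_tail[OF g alpha_pos_mean(1)[OF g a]]
    unfolding alpha_pos_mean(2)[OF g a] by (intro mult_left_mono) auto
  also have "\<dots> = ennreal (gauss_mass g \<rho> * (2 / (alpha g \<rho>)\<^sup>2))"
    by (rule ennreal_mult[symmetric]) (simp_all add: gauss_mass_nonneg)
  finally show ?thesis .
qed

text \<open>The mass lost on the negative half-line lies below m/2, where the tail bound applies
  because the mean m is positive. For \<alpha> far below 0 most of the mass would be lost
  instead.\<close>

lemma site_integral_ge:
  assumes g: "0 < g" and a: "0 < alpha g \<rho>"
  shows "ennreal (gauss_mass g \<rho> * (1 - 2 / (alpha g \<rho>)\<^sup>2)) \<le> site_integral g \<rho> 0"
proof -
  let ?m = "(\<rho> - 1) / (2 * g)"
  let ?N = "density lborel (normal_density ?m (1 / sqrt (2 * g)))"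
  interpret N: prob_space ?N
    using assms by (intro prob_space_normal_density) simp
  have "emeasure ?N {..<0} \<le> emeasure ?N {..< ?m / 2}"
    using alpha_pos_mean(1)[OF g a] by (intro emeasure_mono) auto
  also have "\<dots> \<le> ennreal (2 / (alpha g \<rho>)\<^sup>2)"
    using normal_lower_tail[OF g alpha_pos_mean(1)[OF g a]]
    unfolding alpha_pos_mean(2)[OF g a] .
  finally have "N.prob {..<0} \<le> 2 / (alpha g \<rho>)\<^sup>2"
    by (simp add: N.emeasure_eq_measure)
  moreover have "N.prob {0..} = 1 - N.prob {..<0}"
    using N.prob_compl[of "{..<0}"] by (simp add: space_density Compl_eq_Diff_UNIV[symmetric] Compl_lessThan)
  ultimately have "gauss_mass g \<rho> * (1 - 2 / (alpha g \<rho>)\<^sup>2) \<le> gauss_mass g \<rho> * N.prob {0..}"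
    by (intro mult_left_mono gauss_mass_nonneg) simp
  then have "ennreal (gauss_mass g \<rho> * (1 - 2 / (alpha g \<rho>)\<^sup>2)) \<le> ennreal (gauss_mass g \<rho>) * emeasure ?N {0..}"
    by (simp add: N.emeasure_eq_measure ennreal_mult'[symmetric] gauss_mass_nonneg ennreal_leI)
  also have "\<dots> = (\<integral>\<^sup>+ s. ennreal (site_weight g \<rho> 0 s) * 1 \<partial>Exp1)"
    unfolding nn_integral_site_weight[OF g borel_measurable_const]
    by simp
  finally show ?thesis by (simp add: site_integral_def)
qed

text \<open>Under the tilted law a holding time concentrates at \<open>m = \<alpha> / \<surd> g\<close>; two holding times at the
  same site then cost a factor \<open>exp (- 2 g m\<^sup>2) = exp (- 2 \<alpha>\<^sup>2)\<close>.\<close>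

lemma repeated_site_integral_le:
  assumes g: "0 < g" and a: "0 < alpha g \<rho>"
  shows "(\<integral>\<^sup>+ s. ennreal (site_weight g \<rho> 0 s) * site_integral g \<rho> s \<partial>Exp1)
     \<le> ennreal ((gauss_mass g \<rho>)\<^sup>2 * (4 / (alpha g \<rho>)\<^sup>2 + exp (- ((alpha g \<rho>)\<^sup>2 / 2))))"
proof -
  define m where "m = (\<rho> - 1) / (2 * g)"
  define S where "S = gauss_mass g \<rho>"
  \<comment> \<open>When both holding times are at least m/2, the cross term 2 g (m/2) (m/2) equals
    \<alpha>^2/2. This is weaker than the heuristic gain but still tends to infinity.\<close>
  define e where "e = exp (- ((alpha g \<rho>)\<^sup>2 / 2))"
  define q where "q = 2 / (alpha g \<rho>)\<^sup>2"
  have m: "0 < m" "g * m\<^sup>2 = (alpha g \<rho>)\<^sup>2"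
    using alpha_pos_mean[OF g a] by (auto simp: m_def)
  have S: "0 \<le> S" by (simp add: S_def gauss_mass_nonneg)
  have q: "0 \<le> q" by (simp add: q_def)
  have e: "0 \<le> e" by (simp add: e_def)
  define \<tau> where "\<tau> = (\<integral>\<^sup>+ s. ennreal (site_weight g \<rho> 0 s) * indicator {..< m / 2} s \<partial>Exp1)"
  have \<tau>: "\<tau> \<le> ennreal (S * q)"
    using site_weight_lower_tail[OF g a] by (simp add: \<tau>_def m_def S_def q_def)
  have I: "site_integral g \<rho> 0 \<le> ennreal S"
    using site_integral_le[OF g] by (simp add: S_def)
  have "site_integral g \<rho> (m / 2)
      \<le> (\<integral>\<^sup>+ s. ennreal (site_weight g \<rho> 0 s) * indicator {..< m / 2} s
                + ennreal (site_weight g \<rho> 0 s) * ennreal e \<partial>Exp1)"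
    unfolding site_integral_def
  proof (intro nn_integral_mono_AE eventually_mono[OF AE_Exp1_nonneg])
    fix s :: real assume s: "0 \<le> s"
    show "ennreal (site_weight g \<rho> (m / 2) s)
       \<le> ennreal (site_weight g \<rho> 0 s) * indicator {..< m / 2} s + ennreal (site_weight g \<rho> 0 s) * ennreal e"
    proof (cases "s < m / 2")
      case True
      then show ?thesis
        using site_weight_antimono[of g 0 "m / 2" s \<rho>] g m s
        by (auto intro!: add_increasing2 ennreal_leI)
    next
      case False
      then have "g * (m * (m / 2)) \<le> g * (m * s)"
        using g m by (intro mult_left_mono) auto
      then have "- (g * (2 * (m / 2) * s)) \<le> - ((alpha g \<rho>)\<^sup>2 / 2)"
        unfolding m(2)[symmetric] by (simp add: power2_eq_square)
      then have "site_weight g \<rho> (m / 2) s \<le> site_weight g \<rho> 0 s * e"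
        unfolding site_weight_def e_def exp_add[symmetric] by (simp add: algebra_simps)
      then have "ennreal (site_weight g \<rho> (m / 2) s) \<le> ennreal (site_weight g \<rho> 0 s * e)"
        by (rule ennreal_leI)
      then show ?thesis using False e
        by (simp add: ennreal_mult''[symmetric])
    qed
  qed
  also have "\<dots> = \<tau> + site_integral g \<rho> 0 * ennreal e"
    unfolding \<tau>_def site_integral_def by (subst nn_integral_add) (auto simp: nn_integral_multc)
  also have "\<dots> \<le> ennreal (S * q) + ennreal S * ennreal e"
    by (intro add_mono mult_right_mono \<tau> I) auto
  also have "\<dots> = ennreal (S * (q + e))"
    using S q e by (simp add: ennreal_plus[symmetric] ennreal_mult'[symmetric] distrib_left del: ennreal_plus)
  finally have h: "site_integral g \<rho> (m / 2) \<le> ennreal (S * (q + e))" .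
  \<comment> \<open>The first holding time is split at m/2: a short one is paid for by the tail
    \<open>\<tau>\<close>, and after a long one monotonicity and \<open>h\<close> bound the second
    integral. Each of the two holding times contributes one tail \<open>q\<close>, whence
    4/\<alpha>^2.\<close>
  have "(\<integral>\<^sup>+ s. ennreal (site_weight g \<rho> 0 s) * site_integral g \<rho> s \<partial>Exp1)
     \<le> (\<integral>\<^sup>+ s. ennreal (site_weight g \<rho> 0 s) * indicator {..< m / 2} s * ennreal S
            + ennreal (site_weight g \<rho> 0 s) * ennreal (S * (q + e)) \<partial>Exp1)"
  proof (intro nn_integral_mono_AE eventually_mono[OF AE_Exp1_nonneg])
    fix s :: real assume s: "0 \<le> s"
    show "ennreal (site_weight g \<rho> 0 s) * site_integral g \<rho> s
      \<le> ennreal (site_weight g \<rho> 0 s) * indicator {..< m / 2} s * ennreal S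
            + ennreal (site_weight g \<rho> 0 s) * ennreal (S * (q + e))"
    proof (cases "s < m / 2")
      case True
      have "site_integral g \<rho> s \<le> ennreal S"
        using site_integral_antimono[of g 0 s \<rho>] g s I by simp
      then show ?thesis using True
        by (simp add: add_increasing2 mult_left_mono)
    next
      case False
      then have "site_integral g \<rho> s \<le> ennreal (S * (q + e))"
        using site_integral_antimono[of g "m / 2" s \<rho>] g h by simp
      then show ?thesis using False by (simp add: mult_left_mono)
    qed
  qed
  also have "\<dots> = \<tau> * ennreal S + site_integral g \<rho> 0 * ennreal (S * (q + e))"
    unfolding \<tau>_def site_integral_def by (subst nn_integral_add) (auto simp: nn_integral_multc)
  also have "\<dots> \<le> ennreal (S * q) * ennreal S + ennreal S * ennreal (S * (q + e))"
    by (intro add_mono mult_right_mono \<tau> I) auto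
  also have "\<dots> = ennreal (S * q * S + S * (S * (q + e)))"
    using S q e by (simp add: ennreal_plus[symmetric] ennreal_mult'[symmetric] del: ennreal_plus)
  also have "S * q * S + S * (S * (q + e)) = S\<^sup>2 * (4 / (alpha g \<rho>)\<^sup>2 + e)"
    by (simp add: q_def power2_eq_square algebra_simps)
  finally show ?thesis by (simp add: S_def e_def)
qed

section \<open>The weight of a walk\<close>

text \<open>\<open>l\<close> is the local time already accumulated at each site: since
  \<open>(l + s)\<^sup>2 = l\<^sup>2 + (s\<^sup>2 + 2 l s)\<close>, revisiting a site is penalised by the cross term, and the weight
  is decreasing in \<open>l\<close>.\<close>

fun walk_weight :: "real \<Rightarrow> real \<Rightarrow> ('a \<Rightarrow> real) \<Rightarrow> 'a list \<Rightarrow> ennreal" where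
  "walk_weight g \<rho> l [] = 1"
| "walk_weight g \<rho> l (v # vs) =
     (\<integral>\<^sup>+ s. ennreal (site_weight g \<rho> (l v) s) * walk_weight g \<rho> (l(v := l v + s)) vs \<partial>Exp1)"

text \<open>Measurability is proved in the whole field \<open>l\<close>, because the recursive call
  evaluates the weight at an updated field inside an integral.\<close>

lemma walk_weight_measurable [measurable]:
  "(\<lambda>l. walk_weight g \<rho> l ys) \<in> borel_measurable (Pi\<^sub>M UNIV (\<lambda>_. borel))"
proof (induction ys)
  case (Cons v vs)
  note [measurable] = Cons.IH
  have upd: "(\<lambda>(l, s). l(v := l v + s)) \<in>
      Pi\<^sub>M UNIV (\<lambda>_. borel) \<Otimes>\<^sub>M borel \<rightarrow>\<^sub>M Pi\<^sub>M UNIV (\<lambda>_. borel :: real measure)"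
    by (intro measurable_PiM_single') (auto simp: fun_upd_def split_beta PiE_iff)
  have "(\<lambda>x. walk_weight g \<rho> ((\<lambda>(l, s). l(v := l v + s)) x) vs)
      \<in> borel_measurable (Pi\<^sub>M UNIV (\<lambda>_. borel) \<Otimes>\<^sub>M borel)"
    using upd by measurable
  then have [measurable]: "(\<lambda>(l, s). walk_weight g \<rho> (l(v := l v + s)) vs)
      \<in> borel_measurable (Pi\<^sub>M UNIV (\<lambda>_. borel) \<Otimes>\<^sub>M Exp1)"
    by (simp add: split_beta' cong: measurable_cong_sets)
  show ?case by simp
qed simp

lemma walk_weight_upd_measurable [measurable]:
  "(\<lambda>s. walk_weight g \<rho> (l(v := l v + s)) ys) \<in> borel_measurable borel"
proof -
  have "(\<lambda>s. l(v := l v + s)) \<in> borel \<rightarrow>\<^sub>M Pi\<^sub>M UNIV (\<lambda>_. borel :: real measure)"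
    by (intro measurable_PiM_single') (auto simp: fun_upd_def PiE_iff)
  then show ?thesis by measurable
qed

section \<open>Monotonicity in the local times, and bounds obtained by dropping interactions\<close>

lemma walk_weight_antimono:
  assumes "0 \<le> g" "\<And>v. l v \<le> l' v"
  shows "walk_weight g \<rho> l' ys \<le> walk_weight g \<rho> l ys"
  using assms(2)
proof (induction ys arbitrary: l l')
  case (Cons v vs)
  show ?case unfolding walk_weight.simps
  proof (intro nn_integral_mono_AE eventually_mono[OF AE_Exp1_nonneg] mult_mono)
    fix s :: real assume "0 \<le> s"
    then show "ennreal (site_weight g \<rho> (l' v) s) \<le> ennreal (site_weight g \<rho> (l v) s)"
      using assms(1) Cons.prems by (intro ennreal_leI site_weight_antimono)
    show "walk_weight g \<rho> (l'(v := l' v + s)) vs \<le> walk_weight g \<rho> (l(v := l v + s)) vs"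
      using Cons.prems by (intro Cons.IH) auto
  qed auto
qed simp

text \<open>Resetting the nonnegative local times to 0 after \<open>xs\<close> can only raise the
  weight, and the reset factor is a constant that leaves the integral.\<close>

lemma walk_weight_append_le:
  assumes "0 \<le> g" "\<And>v. 0 \<le> l v"
  shows "walk_weight g \<rho> l (xs @ ys) \<le> walk_weight g \<rho> l xs * walk_weight g \<rho> (\<lambda>_. 0) ys"
  using assms(2)
proof (induction xs arbitrary: l)
  case Nil
  then show ?case by (simp add: walk_weight_antimono[OF assms(1)])
next
  case (Cons v vs)
  have "walk_weight g \<rho> l ((v # vs) @ ys) \<le>
    (\<integral>\<^sup>+ s. (ennreal (site_weight g \<rho> (l v) s) * walk_weight g \<rho> (l(v := l v + s)) vs)
        * walk_weight g \<rho> (\<lambda>_. 0) ys \<partial>Exp1)"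
    unfolding append_Cons walk_weight.simps mult.assoc
    by (intro nn_integral_mono_AE eventually_mono[OF AE_Exp1_nonneg] mult_left_mono Cons.IH)
       (use Cons.prems in auto)
  also have "\<dots> = walk_weight g \<rho> l (v # vs) * walk_weight g \<rho> (\<lambda>_. 0) ys"
    by (subst nn_integral_multc) auto
  finally show ?case .
qed

text \<open>The weight sees only which sites coincide. Applied to translations of the lattice, this
  lets every block of a walk start at the origin.\<close>

lemma walk_weight_map_inj:
  assumes "inj f"
  shows "walk_weight g \<rho> l (map f ys) = walk_weight g \<rho> (l \<circ> f) ys"
proof (induction ys arbitrary: l)
  case (Cons v vs)
  have "l(f v := t) \<circ> f = (l \<circ> f)(v := t)" for t
    using assms by (auto simp: fun_eq_iff inj_eq)
  then show ?case by (simp add: Cons comp_def del: fun_upd_apply)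
qed simp

text \<open>Every site is still fresh when it is reached: an update of the field touches only a site
  that does not recur.\<close>

lemma walk_weight_distinct:
  assumes "distinct ys" "\<And>v. v \<in> set ys \<Longrightarrow> l v = 0"
  shows "walk_weight g \<rho> l ys = site_integral g \<rho> 0 ^ length ys"
  using assms
proof (induction ys arbitrary: l)
  case (Cons v vs)
  have "walk_weight g \<rho> l (v # vs)
     = (\<integral>\<^sup>+ s. ennreal (site_weight g \<rho> 0 s) * site_integral g \<rho> 0 ^ length vs \<partial>Exp1)"
    unfolding walk_weight.simps
    using Cons.prems by (intro nn_integral_cong arg_cong2[of _ _ _ _ "(*)"] Cons.IH) auto
  then show ?case
    by (simp add: nn_integral_multc site_integral_def)
qed simp

text \<open>Of all interactions only that of the last holding time with the initial local time at
  \<open>v\<close> is kept; whatever \<open>ws\<close> adds at \<open>v\<close> is discarded by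
  monotonicity. This serves to close a loop at \<open>v\<close>.\<close>

lemma walk_weight_snoc_le:
  assumes "0 \<le> g" "\<And>v. 0 \<le> l v"
  shows "walk_weight g \<rho> l (ws @ [v]) \<le> site_integral g \<rho> 0 ^ length ws * site_integral g \<rho> (l v)"
  using assms(2)
proof (induction ws arbitrary: l)
  case Nil
  show ?case by (simp add: site_integral_def)
next
  case (Cons u us)
  have "walk_weight g \<rho> l ((u # us) @ [v]) \<le>
    (\<integral>\<^sup>+ s. ennreal (site_weight g \<rho> 0 s) * (site_integral g \<rho> 0 ^ length us * site_integral g \<rho> (l v)) \<partial>Exp1)"
    unfolding append_Cons walk_weight.simps
  proof (intro nn_integral_mono_AE eventually_mono[OF AE_Exp1_nonneg] mult_mono)
    fix s :: real assume s: "0 \<le> s"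
    then show "ennreal (site_weight g \<rho> (l u) s) \<le> ennreal (site_weight g \<rho> 0 s)"
      using assms(1) Cons.prems by (intro ennreal_leI site_weight_antimono)
    have "walk_weight g \<rho> (l(u := l u + s)) (us @ [v])
        \<le> site_integral g \<rho> 0 ^ length us * site_integral g \<rho> ((l(u := l u + s)) v)"
      using s Cons.prems by (intro Cons.IH) auto
    also have "\<dots> \<le> site_integral g \<rho> 0 ^ length us * site_integral g \<rho> (l v)"
      using s assms(1) by (intro mult_left_mono site_integral_antimono) auto
    finally show "walk_weight g \<rho> (l(u := l u + s)) (us @ [v])
        \<le> site_integral g \<rho> 0 ^ length us * site_integral g \<rho> (l v)" .
  qed auto
  also have "\<dots> = site_integral g \<rho> 0 * (site_integral g \<rho> 0 ^ length us * site_integral g \<rho> (l v))"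
    by (simp add: nn_integral_multc site_integral_def)
  finally show ?case by (simp add: mult.assoc)
qed

lemma walk_weight_le_power:
  assumes "0 \<le> g"
  shows "walk_weight g \<rho> (\<lambda>_. 0) ys \<le> site_integral g \<rho> 0 ^ length ys"
proof (cases ys rule: rev_cases)
  case (snoc ws v)
  then show ?thesis
    using walk_weight_snoc_le[OF assms, of "\<lambda>_. 0" \<rho> ws v] by (simp add: mult.commute)
qed simp

text \<open>A single coincidence is enough. The walk is cut around a loop from \<open>v\<close> back
  to \<open>v\<close>; inside the loop the first holding time becomes the accumulated local time
  against which the return is penalised.\<close>

lemma walk_weight_repeated_le:
  assumes "0 \<le> g"
  shows "walk_weight g \<rho> (\<lambda>_. 0) (us @ [v] @ ws @ [v] @ ts)
     \<le> site_integral g \<rho> 0 ^ (length us + length ws + length ts) *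
       (\<integral>\<^sup>+ s. ennreal (site_weight g \<rho> 0 s) * site_integral g \<rho> s \<partial>Exp1)"
    (is "_ \<le> _ * ?R")
proof -
  let ?W = "walk_weight g \<rho> (\<lambda>_. 0)" and ?I = "site_integral g \<rho> 0"
  have [measurable]: "(\<lambda>s. site_integral g \<rho> s) \<in> borel_measurable borel"
    unfolding site_integral_def by measurable
  have mid: "?W ((v # ws) @ [v]) \<le> ?I ^ length ws * ?R"
  proof -
    have "?W ((v # ws) @ [v])
       \<le> (\<integral>\<^sup>+ s. ?I ^ length ws * (ennreal (site_weight g \<rho> 0 s) * site_integral g \<rho> s) \<partial>Exp1)"
      unfolding append_Cons walk_weight.simps
    proof (intro nn_integral_mono_AE eventually_mono[OF AE_Exp1_nonneg])
      fix s :: real assume s: "0 \<le> s"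
      have "walk_weight g \<rho> ((\<lambda>_. 0)(v := 0 + s)) (ws @ [v])
        \<le> ?I ^ length ws * site_integral g \<rho> (((\<lambda>_. 0)(v := 0 + s)) v)"
        using s by (intro walk_weight_snoc_le assms) auto
      then show "ennreal (site_weight g \<rho> 0 s) * walk_weight g \<rho> ((\<lambda>_. 0)(v := 0 + s)) (ws @ [v])
        \<le> ?I ^ length ws * (ennreal (site_weight g \<rho> 0 s) * site_integral g \<rho> s)"
        by (subst mult.left_commute) (intro mult_left_mono, auto)
    qed
    then show ?thesis by (subst (asm) nn_integral_cmult) auto
  qed
  have "?W (us @ [v] @ ws @ [v] @ ts) \<le> ?W us * ?W (((v # ws) @ [v]) @ ts)"
    using walk_weight_append_le[OF assms, of "\<lambda>_. 0" \<rho> us "((v # ws) @ [v]) @ ts"] by simp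
  also have "\<dots> \<le> ?W us * (?W ((v # ws) @ [v]) * ?W ts)"
    by (intro mult_left_mono walk_weight_append_le assms) auto
  also have "\<dots> \<le> ?I ^ length us * ((?I ^ length ws * ?R) * ?I ^ length ts)"
    by (intro mult_mono walk_weight_le_power assms mid) auto
  finally show ?thesis by (simp add: power_add mult_ac)
qed

section \<open>The strong interaction limit of the weight of a walk\<close>

text \<open>For positive p the exponential of \<alpha>^2 grows like p sqrt g. Only the square is
  controlled here; the sign of \<alpha> is a separate matter.\<close>

lemma alpha_sq_at_top:
  assumes p: "0 < p"
    and lim: "((\<lambda>g. g powr (- 1 / 2) * exp ((alpha g (\<rho> g))\<^sup>2)) \<longlongrightarrow> p) at_top"
  shows "filterlim (\<lambda>g. (alpha g (\<rho> g))\<^sup>2) at_top at_top"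
proof -
  have "filterlim (\<lambda>g. g powr (- 1 / 2) * exp ((alpha g (\<rho> g))\<^sup>2) * sqrt g) at_top at_top"
    by (rule filterlim_tendsto_pos_mult_at_top[OF lim p sqrt_at_top])
  moreover have "\<forall>\<^sub>F g in at_top.
      g powr (- 1 / 2) * exp ((alpha g (\<rho> g))\<^sup>2) * sqrt g = exp ((alpha g (\<rho> g))\<^sup>2)"
    using eventually_gt_at_top[of 0]
    by eventually_elim (simp add: powr_minus powr_half_sqrt field_simps)
  ultimately have "filterlim (\<lambda>g. exp ((alpha g (\<rho> g))\<^sup>2)) at_top at_top"
    by (rule filterlim_cong[OF refl refl, THEN iffD1, rotated])
  from filterlim_compose[OF ln_at_top this] show ?thesis by simp
qed

lemma gauss_mass_tendsto:
  assumes "((\<lambda>g. g powr (- 1 / 2) * exp ((alpha g (\<rho> g))\<^sup>2)) \<longlongrightarrow> p) at_top"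
  shows "((\<lambda>g. gauss_mass g (\<rho> g)) \<longlongrightarrow> p * sqrt pi) at_top"
  unfolding gauss_mass_def mult.commute[of p] by (rule tendsto_mult[OF tendsto_const assms])

text \<open>The power of the Gaussian mass bounds the weight in all cases, and for p = 0 it forces
  the limit 0 although \<alpha> need not diverge. For p > 0 the divergence of \<alpha> removes the
  tail errors, both in the lower bound for distinct sites and in the upper bound for a repeated
  site.\<close>

lemma walk_weight_tendsto:
  fixes ys :: "'a list"
  assumes p: "0 \<le> p" and ys: "ys \<noteq> []"
    and lim: "((\<lambda>g. g powr (- 1 / 2) * exp ((alpha g (\<rho> g))\<^sup>2)) \<longlongrightarrow> p) at_top"
    and branch: "0 < p \<Longrightarrow> \<forall>\<^sub>F g in at_top. 0 \<le> alpha g (\<rho> g)"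
  shows "((\<lambda>g. walk_weight g (\<rho> g) (\<lambda>_. 0) ys) \<longlongrightarrow>
            ennreal (of_bool (distinct ys) * (p * sqrt pi) ^ length ys)) at_top"
proof -
  let ?S = "\<lambda>g. gauss_mass g (\<rho> g)" and ?a = "\<lambda>g. alpha g (\<rho> g)"
  let ?W = "\<lambda>g. walk_weight g (\<rho> g) (\<lambda>_. 0) ys"
  note S = gauss_mass_tendsto[OF lim]
  have le_power: "\<forall>\<^sub>F g in at_top. ?W g \<le> ennreal (?S g ^ length ys)"
    using eventually_gt_at_top[of 0]
  proof eventually_elim
    case (elim g)
    have "?W g \<le> site_integral g (\<rho> g) 0 ^ length ys"
      using elim by (intro walk_weight_le_power) simp
    also have "\<dots> \<le> ennreal (?S g) ^ length ys"
      using elim by (intro power_mono site_integral_le) auto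
    finally show ?case by (simp add: ennreal_power gauss_mass_nonneg)
  qed
  have S_power: "((\<lambda>g. ennreal (?S g ^ length ys)) \<longlongrightarrow> ennreal ((p * sqrt pi) ^ length ys)) at_top"
    by (intro tendsto_ennrealI tendsto_power S)
  show ?thesis
  proof (cases "p = 0")
    case True
    have "(?W \<longlongrightarrow> 0) at_top"
      by (rule tendsto_sandwich[OF _ le_power tendsto_const])
         (use S_power True ys in \<open>auto simp: power_0_left\<close>)
    then show ?thesis using True ys by (simp add: power_0_left)
  next
    case False
    then have p: "0 < p" using p by simp
    note top = alpha_sq_at_top[OF p lim]
    \<comment> \<open>\<open>branch\<close> supplies the sign of \<alpha>, and the divergence of its
      square excludes the value 0.\<close>
    have a: "\<forall>\<^sub>F g in at_top. 0 < g \<and> 0 < ?a g"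
      using branch[OF p] filterlim_at_top_dense[THEN iffD1, OF top, rule_format, of 0]
        eventually_gt_at_top[of 0]
      by eventually_elim (auto simp: less_le)
    have inv: "((\<lambda>g. c / (?a g)\<^sup>2) \<longlongrightarrow> 0) at_top" for c
      by (rule real_tendsto_divide_at_top[OF tendsto_const top])
    have exp0: "((\<lambda>g. exp (- ((?a g)\<^sup>2 / 2))) \<longlongrightarrow> 0) at_top"
      by (rule filterlim_compose[OF exp_at_bot])
         (use filterlim_tendsto_pos_mult_at_top[OF tendsto_const[of "1/2"] _ top]
          in \<open>simp add: filterlim_uminus_at_bot\<close>)
    show ?thesis
    proof (cases "distinct ys")
      case True
      have "((\<lambda>g. ennreal ((?S g * (1 - 2 / (?a g)\<^sup>2)) ^ length ys))
          \<longlongrightarrow> ennreal (((p * sqrt pi) * (1 - 0)) ^ length ys)) at_top"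
        by (intro tendsto_ennrealI tendsto_power tendsto_mult tendsto_diff S inv tendsto_const)
      moreover have "\<forall>\<^sub>F g in at_top. ennreal ((?S g * (1 - 2 / (?a g)\<^sup>2)) ^ length ys) \<le> ?W g"
        using a filterlim_at_top_dense[THEN iffD1, OF top, rule_format, of 2]
      proof eventually_elim
        case (elim g)
        \<comment> \<open>Beyond \<alpha>^2 = 2 the factor is nonnegative, so \<open>ennreal\<close>
          does not truncate it and commutes with the power.\<close>
        have "0 \<le> ?S g * (1 - 2 / (?a g)\<^sup>2)"
          using elim by (intro mult_nonneg_nonneg gauss_mass_nonneg) (simp add: field_simps)
        then have "ennreal ((?S g * (1 - 2 / (?a g)\<^sup>2)) ^ length ys)
           = ennreal (?S g * (1 - 2 / (?a g)\<^sup>2)) ^ length ys"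
          by (simp add: ennreal_power)
        also have "\<dots> \<le> site_integral g (\<rho> g) 0 ^ length ys"
          using elim by (intro power_mono site_integral_ge) auto
        also have "\<dots> = ?W g"
          using True by (simp add: walk_weight_distinct)
        finally show ?case .
      qed
      ultimately have "(?W \<longlongrightarrow> ennreal ((p * sqrt pi) ^ length ys)) at_top"
        using tendsto_sandwich[OF _ le_power _ S_power] by simp
      then show ?thesis using True by simp
    next
      case False
      then obtain us v ws ts where ys': "ys = us @ [v] @ ws @ [v] @ ts"
        using not_distinct_decomp by blast
      define n where "n = length us + length ws + length ts"
      have "((\<lambda>g. ennreal (?S g ^ n * ((?S g)\<^sup>2 * (4 / (?a g)\<^sup>2 + exp (- ((?a g)\<^sup>2 / 2))))))
          \<longlongrightarrow> ennreal ((p * sqrt pi) ^ n * ((p * sqrt pi)\<^sup>2 * (0 + 0)))) at_top"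
        by (intro tendsto_ennrealI tendsto_power tendsto_mult tendsto_add S inv exp0)
      moreover have "\<forall>\<^sub>F g in at_top.
          ?W g \<le> ennreal (?S g ^ n * ((?S g)\<^sup>2 * (4 / (?a g)\<^sup>2 + exp (- ((?a g)\<^sup>2 / 2)))))"
        using a
      proof eventually_elim
        case (elim g)
        have "?W g \<le> site_integral g (\<rho> g) 0 ^ n *
          (\<integral>\<^sup>+ s. ennreal (site_weight g (\<rho> g) 0 s) * site_integral g (\<rho> g) s \<partial>Exp1)"
          unfolding ys' n_def using elim by (intro walk_weight_repeated_le) simp
        also have "\<dots> \<le> ennreal (?S g) ^ n *
            ennreal ((?S g)\<^sup>2 * (4 / (?a g)\<^sup>2 + exp (- ((?a g)\<^sup>2 / 2))))"
          using elim by (intro mult_mono power_mono site_integral_le repeated_site_integral_le) auto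
        also have "\<dots> = ennreal (?S g ^ n * ((?S g)\<^sup>2 * (4 / (?a g)\<^sup>2 + exp (- ((?a g)\<^sup>2 / 2)))))"
          by (simp add: ennreal_power gauss_mass_nonneg ennreal_mult')
        finally show ?case .
      qed
      ultimately have "(?W \<longlongrightarrow> 0) at_top"
        using tendsto_sandwich[OF always_eventually _ tendsto_const, of 0 ?W] by simp
      then show ?thesis using False by simp
    qed
  qed
qed

section \<open>Submultiplicative sequences\<close>

text \<open>Write n as a multiple of m plus a residue i < m: each block of length m costs r^m, and
  the sum over residues dominates the largest normalised initial value. It serves both the root
  limit below and the domination uniform in g.\<close>

lemma geometric_bound:
  fixes f :: "nat \<Rightarrow> real"
  assumes m: "0 < m" and r: "0 < r" and f: "\<And>n. 0 \<le> f n"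
    and step: "\<And>n. f (n + m) \<le> r ^ m * f n"
  shows "f n \<le> (\<Sum>i<m. f i / r ^ i) * r ^ n"
proof (induction n rule: less_induct)
  case (less n)
  show ?case
  proof (cases "n < m")
    case True
    then have "f n / r ^ n \<le> (\<Sum>i<m. f i / r ^ i)"
      using f r by (intro member_le_sum[where f = "\<lambda>i. f i / r ^ i"]) auto
    then show ?thesis using r by (simp add: field_simps)
  next
    case False
    then have "f n \<le> r ^ m * f (n - m)"
      using step[of "n - m"] by simp
    also have "\<dots> \<le> r ^ m * ((\<Sum>i<m. f i / r ^ i) * r ^ (n - m))"
      using less[of "n - m"] False m r by (intro mult_left_mono) auto
    also have "\<dots> = (\<Sum>i<m. f i / r ^ i) * (r ^ m * r ^ (n - m))"
      by (simp add: mult_ac)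
    also have "r ^ m * r ^ (n - m) = r ^ n"
      using False by (simp add: power_add[symmetric])
    finally show ?thesis .
  qed
qed

text \<open>Fekete's lemma in multiplicative form. Since \<open>connective_constant\<close> is
  defined by \<open>lim\<close>, convergence has to be known before its value says anything about
  the roots.\<close>

lemma submultiplicative_root_convergent:
  fixes c :: "nat \<Rightarrow> real"
  assumes nonneg: "\<And>n. 0 \<le> c n" and submult: "\<And>n m. c (n + m) \<le> c n * c m"
  shows "convergent (\<lambda>n. root n (c n))"
proof -
  \<comment> \<open>The infimum starts at 1 because \<open>root 0\<close> is 0 by
    convention.\<close>
  define L where "L = (INF n\<in>{1..}. root n (c n))"
  have bdd: "bdd_below ((\<lambda>n. root n (c n)) ` {1..})"
    by (rule bdd_belowI[of _ 0]) (use nonneg in auto)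
  have L0: "0 \<le> L"
    unfolding L_def by (intro cINF_greatest) (use nonneg in auto)
  have lower: "L \<le> root n (c n)" if "1 \<le> n" for n
    unfolding L_def by (intro cINF_lower bdd) (use that in auto)
  have upper: "\<forall>\<^sub>F n in sequentially. root n (c n) < L + e" if e: "0 < e" for e
  proof -
    \<comment> \<open>The shift by e/2 keeps \<beta> strictly between L and L + e and positive even
      if L = 0, so that dividing by its powers is legitimate.\<close>
    define \<beta> where "\<beta> = L + e / 2"
    have \<beta>: "0 < \<beta>" "\<beta> < L + e" using L0 e by (auto simp: \<beta>_def)
    have "\<exists>m\<in>{1..}. root m (c m) < \<beta>"
      using cINF_less_iff[OF _ bdd, of \<beta>] e by (auto simp: \<beta>_def L_def)
    then obtain m where m: "1 \<le> m" "root m (c m) < \<beta>" by auto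
    have "c m = root m (c m) ^ m"
      using m nonneg by simp
    also have "\<dots> \<le> \<beta> ^ m"
      using m nonneg by (intro power_mono) auto
    finally have cm: "c m \<le> \<beta> ^ m" .
    \<comment> \<open>Adding 1 makes C positive, so that its n-th roots tend to 1.\<close>
    define C where "C = (\<Sum>i<m. c i / \<beta> ^ i) + 1"
    have sum_nonneg: "0 \<le> (\<Sum>i<m. c i / \<beta> ^ i)"
      using nonneg \<beta> by (intro sum_nonneg) auto
    then have C: "0 < C" by (simp add: C_def)
    have cn: "c n \<le> C * \<beta> ^ n" for n
    proof -
      have "c (n + m) \<le> \<beta> ^ m * c n" for n
        using submult[of n m] mult_left_mono[OF cm nonneg[of n]] by (simp add: mult.commute)
      then have "c n \<le> (\<Sum>i<m. c i / \<beta> ^ i) * \<beta> ^ n"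
        using m \<beta> nonneg by (intro geometric_bound) auto
      also have "\<dots> \<le> C * \<beta> ^ n"
        using \<beta> by (intro mult_right_mono) (auto simp: C_def)
      finally show ?thesis .
    qed
    have "(\<lambda>n. root n C * \<beta>) \<longlonglongrightarrow> 1 * \<beta>"
      by (intro tendsto_mult LIMSEQ_root_const C tendsto_const)
    then have "\<forall>\<^sub>F n in sequentially. root n C * \<beta> < L + e"
      using \<beta> by (intro order_tendstoD(2)[of _ "1 * \<beta>"]) auto
    then show ?thesis
      using eventually_gt_at_top[of 0]
    proof eventually_elim
      case (elim n)
      have "root n (c n) \<le> root n (C * \<beta> ^ n)"
        using elim cn by (intro real_root_le_mono) auto
      also have "\<dots> = root n C * \<beta>"
        using elim \<beta> by (simp add: real_root_mult real_root_power_cancel)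
      finally show ?case using elim by simp
    qed
  qed
  have "(\<lambda>n. root n (c n)) \<longlonglongrightarrow> L"
  proof (rule order_tendstoI)
    fix a assume "a < L"
    then show "\<forall>\<^sub>F n in sequentially. a < root n (c n)"
      using lower by (intro eventually_mono[OF eventually_ge_at_top[of 1]]) (auto intro: less_le_trans)
  next
    fix a assume "L < a"
    then show "\<forall>\<^sub>F n in sequentially. root n (c n) < a"
      using upper[of "a - L"] by simp
  qed
  then show ?thesis by (rule convergentI)
qed

section \<open>Walks on the lattice\<close>

definition walks :: "nat \<Rightarrow> (int ^ 'd::finite) list set" where
  "walks n = {ys. length ys = Suc n \<and> hd ys = 0 \<and> (\<forall>i<n. adjacent (ys ! i) (ys ! Suc i))}"

definition unit_steps :: "(int ^ 'd::finite) set" where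
  "unit_steps = {e. adjacent 0 e}"

lemma saws_eq_distinct_walks: "saws n = {ys \<in> walks n. distinct ys}"
  by (auto simp: saws_def walks_def)

lemma adjacent_translate: "adjacent (a + x) (a + y) \<longleftrightarrow> adjacent x y"
  by (simp add: adjacent_def)

lemma finite_unit_steps: "finite (unit_steps :: (int ^ 'd::finite) set)"
proof (rule finite_subset)
  show "(unit_steps :: (int ^ 'd) set) \<subseteq> vec_lambda ` (PiE UNIV (\<lambda>_. {-1..1}))"
  proof
    fix e :: "int ^ 'd" assume e: "e \<in> unit_steps"
    have "vec_nth e i \<in> {-1..1}" for i
    proof -
      have "\<bar>(\<chi> i. real_of_int (e $ i - (0 :: int ^ 'd) $ i)) $ i\<bar>
          \<le> norm ((\<chi> i. real_of_int (e $ i - (0 :: int ^ 'd) $ i)) :: real ^ 'd)"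
        by (rule component_le_norm_cart)
      then show ?thesis using e by (simp add: unit_steps_def adjacent_def) linarith
    qed
    then have "vec_nth e \<in> PiE UNIV (\<lambda>_. {-1..1})" by auto
    then show "e \<in> vec_lambda ` (PiE UNIV (\<lambda>_. {-1..1}))"
      by (rule rev_image_eqI) simp
  qed
qed (simp add: finite_PiE)

lemma walks_0: "walks 0 = {[0]}"
  by (auto simp: walks_def length_Suc_conv)

lemma walks_ne: "ys \<in> walks n \<Longrightarrow> ys \<noteq> []"
  by (auto simp: walks_def)

section \<open>Cutting and translating walks\<close>

lemma take_walk:
  assumes "ys \<in> walks (n + m)"
  shows "take (Suc n) ys \<in> walks n" "last (take (Suc n) ys) = ys ! n"
  using assms
  by (auto simp: walks_def hd_take) (simp add: take_Suc_conv_app_nth)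

lemma drop_walk:
  assumes "ys \<in> walks (n + m)"
  shows "map (\<lambda>v. v - ys ! n) (drop n ys) \<in> walks m"
proof -
  have "adjacent (ys ! (n + i) - ys ! n) (ys ! Suc (n + i) - ys ! n)" if "i < m" for i
    using assms that adjacent_translate[of "- ys ! n" "ys ! (n + i)" "ys ! Suc (n + i)"]
    by (simp add: walks_def)
  then show ?thesis
    using assms by (auto simp: walks_def hd_map hd_drop_conv_nth)
qed

text \<open>The blocks share no site, as the bound for the weight of an appended list requires; the
  price is the joining step \<open>e\<close>, hence \<open>Suc m\<close>.\<close>

lemma walks_split:
  "walks (n + Suc m) \<subseteq>
    (\<lambda>(us, e, vs). us @ map ((+) (last us + e)) vs) ` (walks n \<times> unit_steps \<times> walks m)"
proof
  fix ys :: "(int ^ 'd) list" assume ys: "ys \<in> walks (n + Suc m)"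
  let ?e = "ys ! Suc n - ys ! n"
  have "map (\<lambda>v. v - ys ! Suc n) (drop (Suc n) ys) \<in> walks m"
    using drop_walk[of ys "Suc n" m] ys by simp
  moreover have "?e \<in> unit_steps"
    using ys adjacent_translate[of "ys ! n" 0 ?e]
    by (simp add: walks_def unit_steps_def)
  moreover have "ys = take (Suc n) ys @ map ((+) (last (take (Suc n) ys) + ?e))
      (map (\<lambda>v. v - ys ! Suc n) (drop (Suc n) ys))"
    using take_walk(2)[OF ys] by (simp add: comp_def)
  ultimately show "ys \<in> (\<lambda>(us, e, vs). us @ map ((+) (last us + e)) vs) `
      (walks n \<times> unit_steps \<times> walks m)"
    using take_walk(1)[OF ys]
    by (intro image_eqI[of _ _ "(take (Suc n) ys, ?e, map (\<lambda>v. v - ys ! Suc n) (drop (Suc n) ys))"]) auto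
qed

lemma finite_walks [simp]: "finite (walks n :: (int ^ 'd::finite) list set)"
proof (induction n)
  case (Suc n)
  have "finite (walks (n + Suc 0) :: (int ^ 'd) list set)"
    by (rule finite_subset[OF walks_split])
       (intro finite_imageI finite_cartesian_product Suc finite_unit_steps, simp add: walks_0)
  then show ?case by simp
qed (simp add: walks_0)

lemma finite_saws [simp]: "finite (saws n :: (int ^ 'd::finite) list set)"
  by (simp add: saws_eq_distinct_walks)

text \<open>Here the two blocks share the site with index n, so that the step numbers add up
  exactly; \<open>tl\<close> removes the duplicate.\<close>

lemma saw_count_submult:
  "saw_count TYPE('d::finite) (n + m) \<le> saw_count TYPE('d) n * saw_count TYPE('d) m"
proof -
  have "(saws (n + m) :: (int ^ 'd) list set) \<subseteq>
    (\<lambda>(us, vs). us @ map ((+) (last us)) (tl vs)) ` (saws n \<times> saws m)"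
  proof
    fix ys :: "(int ^ 'd) list" assume "ys \<in> saws (n + m)"
    then have ys: "ys \<in> walks (n + m)" "distinct ys" by (auto simp: saws_eq_distinct_walks)
    let ?vs = "map (\<lambda>v. v - ys ! n) (drop n ys)"
    have "?vs \<in> saws m"
      using drop_walk[OF ys(1)] ys(2) by (simp add: saws_eq_distinct_walks distinct_map inj_on_def)
    moreover have "take (Suc n) ys \<in> saws n"
      using take_walk(1)[OF ys(1)] ys(2) by (simp add: saws_eq_distinct_walks)
    moreover have "ys = take (Suc n) ys @ map ((+) (last (take (Suc n) ys))) (tl ?vs)"
      using take_walk(2)[OF ys(1)] append_take_drop_id[of "Suc n" ys]
      by (simp add: comp_def map_tl[symmetric] drop_Suc tl_drop)
    ultimately show "ys \<in> (\<lambda>(us, vs). us @ map ((+) (last us)) (tl vs)) ` (saws n \<times> saws m)"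
      by (intro image_eqI[of _ _ "(take (Suc n) ys, ?vs)"]) auto
  qed
  then have "card (saws (n + m) :: (int ^ 'd) list set) \<le> card ((saws n :: (int ^ 'd) list set) \<times> (saws m :: (int ^ 'd) list set))"
    by (rule surj_card_le[rotated]) simp
  then show ?thesis by (simp add: saw_count_def card_cartesian_product)
qed

text \<open>The root test: the n-th root of the term tends to \<mu> z < 1. Only this consequence of
  z < 1/\<mu> enters the choice of the block length.\<close>

lemma saw_count_mult_power_tendsto_0:
  assumes z: "0 \<le> z" "z < inverse (connective_constant TYPE('d::finite))"
  shows "(\<lambda>n. real (saw_count TYPE('d) n) * z ^ n) \<longlonglongrightarrow> 0"
proof -
  let ?c = "\<lambda>n. real (saw_count TYPE('d) n)"
  define \<mu> where "\<mu> = connective_constant TYPE('d)"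
  have "convergent (\<lambda>n. root n (?c n))"
    using saw_count_submult[where 'd = 'd]
    by (intro submultiplicative_root_convergent) (auto simp flip: of_nat_mult)
  then have lim: "(\<lambda>n. root n (?c n)) \<longlonglongrightarrow> \<mu>"
    by (simp add: convergent_LIMSEQ_iff \<mu>_def connective_constant_def)
  \<comment> \<open>As \<open>inverse 0\<close> is 0 and z is nonnegative, the bound on z itself
    forces \<mu> > 0.\<close>
  have "0 < inverse \<mu>" using z unfolding \<mu>_def by (rule le_less_trans)
  then have "0 < \<mu>" by simp
  then have "\<mu> * z < 1" using z by (simp add: \<mu>_def field_simps)
  then obtain \<theta> where \<theta>: "\<mu> * z < \<theta>" "\<theta> < 1" using dense by blast
  have "0 \<le> \<mu> * z" using \<open>0 < \<mu>\<close> z by simp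
  with \<theta> have "0 \<le> \<theta>" by simp
  have "(\<lambda>n. root n (?c n) * z) \<longlonglongrightarrow> \<mu> * z"
    by (intro tendsto_mult lim tendsto_const)
  from order_tendstoD(2)[OF this \<theta>(1)]
  have "\<forall>\<^sub>F n in sequentially. ?c n * z ^ n \<le> \<theta> ^ n"
    using eventually_gt_at_top[of 0]
  proof eventually_elim
    case (elim n)
    have "?c n * z ^ n = (root n (?c n) * z) ^ n"
      using elim by (simp add: power_mult_distrib)
    also have "\<dots> \<le> \<theta> ^ n"
      using elim z by (intro power_mono) auto
    finally show ?case .
  qed
  moreover have "(\<lambda>n. \<theta> ^ n) \<longlonglongrightarrow> 0"
    using \<theta> \<open>0 \<le> \<theta>\<close> by (intro LIMSEQ_realpow_zero)
  ultimately show ?thesis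
    by (rule tendsto_sandwich[OF always_eventually _ tendsto_const, rotated])
       (use z in simp)
qed

section \<open>The strong interaction limit of the sum over walks\<close>

text \<open>Cutting a walk into blocks of \<open>M + 1\<close> sites discards only the interaction between blocks.
  The block sum converges to a multiple of \<open>c\<^sub>M z\<^sup>M\<close>, which is small for large \<open>M\<close>; this gives the
  geometric domination, uniform in \<open>g\<close>, that the exchange of limit and sum requires.\<close>

lemma walk_sum_tendsto:
  fixes x :: "int ^ 'd::finite"
  assumes c: "0 \<le> c" and p: "0 \<le> p"
    and z: "z = c * (p * sqrt pi)" "z < inverse (connective_constant TYPE('d))"
    and lim: "((\<lambda>g. g powr (- 1 / 2) * exp ((alpha g (\<rho> g))\<^sup>2)) \<longlongrightarrow> p) at_top"
    and branch: "0 < p \<Longrightarrow> \<forall>\<^sub>F g in at_top. 0 \<le> alpha g (\<rho> g)"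
  shows "((\<lambda>g. \<Sum>n. ennreal (c ^ n) *
              (\<Sum>ys\<in>{ys \<in> walks n. last ys = x}. walk_weight g (\<rho> g) (\<lambda>_. 0) ys))
           \<longlongrightarrow> ennreal (p * sqrt pi * saw_two_point z x)) at_top"
proof -
  define q where "q = p * sqrt pi"
  \<comment> \<open>The weights are finite for g > 0, and the dominated exchange of limit and sum is
    carried out with real terms.\<close>
  define w :: "real \<Rightarrow> (int ^ 'd) list \<Rightarrow> real"
    where "w = (\<lambda>g ys. enn2real (walk_weight g (\<rho> g) (\<lambda>_. 0) ys))"
  have q: "0 \<le> q" using p by (simp add: q_def)
  have z0: "0 \<le> z" using c p by (simp add: z)
  have w_nonneg: "0 \<le> w g ys" for g ys by (simp add: w_def)
  have finite: "walk_weight g (\<rho> g) (\<lambda>_. 0) ys < \<infinity>" if "0 < g" for g and ys :: "(int ^ 'd) list"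
  proof -
    have "walk_weight g (\<rho> g) (\<lambda>_. 0) ys \<le> ennreal (gauss_mass g (\<rho> g)) ^ length ys"
      using that
      by (intro order_trans[OF walk_weight_le_power] power_mono site_integral_le) auto
    also have "\<dots> < \<infinity>"
      by (simp add: ennreal_power gauss_mass_nonneg)
    finally show ?thesis .
  qed
  have W: "walk_weight g (\<rho> g) (\<lambda>_. 0) ys = ennreal (w g ys)" if "0 < g" for g ys
    using finite[OF that, of ys] by (simp add: w_def)
  have w_lim: "((\<lambda>g. w g ys) \<longlongrightarrow> of_bool (distinct ys) * q ^ length ys) at_top" if "ys \<noteq> []" for ys
  proof -
    show ?thesis
      unfolding w_def q_def
      by (rule tendsto_enn2real[OF walk_weight_tendsto[OF p that lim branch]]) (use p in auto)
  qed
  have w_append: "w g (xs @ ys) \<le> w g xs * w g ys" if "0 < g" for g xs ys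
    using walk_weight_append_le[of g "\<lambda>_. 0" "\<rho> g" xs ys] that W[OF that] w_nonneg
    by (simp add: ennreal_mult'[symmetric] ennreal_le_iff)
  have w_translate: "w g (map ((+) a) ys) = w g ys" for g a ys
    unfolding w_def by (subst walk_weight_map_inj) (auto simp: comp_def)

  \<comment> \<open>Cutting a walk does not preserve its endpoint, so the recursion runs over walks
    with arbitrary endpoint and \<open>b\<close> dominates \<open>a\<close>.\<close>
  define b where "b = (\<lambda>n g. c ^ n * (\<Sum>ys\<in>walks n. w g ys))"
  define a where "a = (\<lambda>n g. c ^ n * (\<Sum>ys\<in>{ys \<in> walks n. last ys = x}. w g ys))"
  \<comment> \<open>The number of choices for the step that joins two blocks.\<close>
  define B where "B = real (card (unit_steps :: (int ^ 'd) set))"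
  \<comment> \<open>A walk with n steps has n + 1 sites: n factors q combine with c^n to z^n, and
    the remaining q is the prefactor of the final limit.\<close>
  have sum_lim: "((\<lambda>g. c ^ n * (\<Sum>ys\<in>{ys \<in> walks n. P ys}. w g ys)) \<longlongrightarrow>
      q * (real (card {ys \<in> saws n. P ys}) * z ^ n)) at_top" for n P
  proof -
    have "((\<lambda>g. c ^ n * (\<Sum>ys\<in>{ys \<in> walks n. P ys}. w g ys)) \<longlongrightarrow>
      c ^ n * (\<Sum>ys\<in>{ys \<in> walks n. P ys}. of_bool (distinct ys) * q ^ length ys)) at_top"
      by (intro tendsto_mult tendsto_const tendsto_sum w_lim) (auto dest: walks_ne)
    also have "(\<Sum>ys\<in>{ys \<in> walks n. P ys}. of_bool (distinct ys) * q ^ length ys)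
       = (\<Sum>ys\<in>{ys \<in> saws n. P ys}. q ^ Suc n)"
      by (rule sum.mono_neutral_cong_right) (simp, auto simp: saws_eq_distinct_walks walks_def)
    also have "c ^ n * \<dots> = q * (real (card {ys \<in> saws n. P ys}) * z ^ n)"
      by (simp add: z q_def power_mult_distrib)
    finally show ?thesis .
  qed
  have b_lim: "((\<lambda>g. b n g) \<longlongrightarrow> q * (real (saw_count TYPE('d) n) * z ^ n)) at_top" for n
    using sum_lim[of n "\<lambda>_. True"] by (simp add: b_def saw_count_def)
  have a_lim: "((\<lambda>g. a n g) \<longlongrightarrow> q * (real (saw_count_to n x) * z ^ n)) at_top" for n
    using sum_lim[of n "\<lambda>ys. last ys = x"] by (simp add: a_def saw_count_to_def)
  have b_nonneg: "0 \<le> b n g" for n g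
    unfolding b_def using c w_nonneg by (intro mult_nonneg_nonneg sum_nonneg) auto
  have a_nonneg: "0 \<le> a n g" for n g
    unfolding a_def using c w_nonneg by (intro mult_nonneg_nonneg sum_nonneg) auto
  have a_le_b: "a n g \<le> b n g" for n g
    unfolding a_def b_def using c w_nonneg by (intro mult_left_mono sum_mono2) auto

  \<comment> \<open>The joining step accounts for the extra factor \<open>B * c\<close>.\<close>
  have block: "b (n + Suc m) g \<le> B * c * b m g * b n g" if g: "0 < g" for n m g
  proof -
    let ?f = "\<lambda>(us, e, vs). us @ map ((+) (last us + e)) vs"
    let ?A = "walks n \<times> unit_steps \<times> walks m :: ((int ^ 'd) list \<times> (int ^ 'd) \<times> (int ^ 'd) list) set"
    have fin: "finite ?A" by (intro finite_cartesian_product finite_walks finite_unit_steps)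
    have "(\<Sum>ys\<in>walks (n + Suc m). w g ys) \<le> (\<Sum>ys\<in>?f ` ?A. w g ys)"
      using walks_split[of n m] fin w_nonneg by (intro sum_mono2) auto
    also have "\<dots> \<le> (\<Sum>t\<in>?A. (w g \<circ> ?f) t)"
      using fin w_nonneg by (intro sum_image_le) auto
    also have "\<dots> \<le> (\<Sum>(us, e, vs)\<in>?A. w g us * w g vs)"
    proof (rule sum_mono)
      fix t :: "(int ^ 'd) list \<times> (int ^ 'd) \<times> (int ^ 'd) list"
      obtain us e vs where t: "t = (us, e, vs)" by (cases t)
      show "(w g \<circ> ?f) t \<le> (case t of (us, e, vs) \<Rightarrow> w g us * w g vs)"
        using w_append[OF g, of us "map ((+) (last us + e)) vs"] unfolding w_translate by (simp add: t)
    qed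
    also have "\<dots> = (\<Sum>us\<in>walks n. \<Sum>e\<in>(unit_steps :: (int ^ 'd) set). \<Sum>vs\<in>walks m. w g us * w g vs)"
      by (simp only: sum.cartesian_product split_beta fst_conv snd_conv)
    also have "\<dots> = B * (\<Sum>us\<in>walks m. w g us) * (\<Sum>us\<in>walks n. w g us)"
      by (simp add: B_def sum_distrib_left[symmetric] sum_distrib_right[symmetric] mult_ac)
    finally have "c ^ (n + Suc m) * (\<Sum>ys\<in>walks (n + Suc m). w g ys)
       \<le> c ^ (n + Suc m) * (B * (\<Sum>us\<in>walks m. w g us) * (\<Sum>us\<in>walks n. w g us))"
      using c by (intro mult_left_mono) auto
    then show ?thesis by (simp add: b_def power_add mult_ac)
  qed

  \<comment> \<open>Since c q = z, this is the limit of \<open>B * c * b m g\<close> for large g. It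
    vanishes as m grows, so some m brings it below 1/2; the value 1/2 stands for any constant below
    1.\<close>
  have "(\<lambda>m. B * z * (real (saw_count TYPE('d) m) * z ^ m)) \<longlonglongrightarrow> B * z * 0"
    by (intro tendsto_mult tendsto_const saw_count_mult_power_tendsto_0 z0 z)
  then have "\<forall>\<^sub>F m in sequentially. B * z * (real (saw_count TYPE('d) m) * z ^ m) < 1 / 2"
    by (rule order_tendstoD) simp
  then obtain m where m: "B * z * (real (saw_count TYPE('d) m) * z ^ m) < 1 / 2"
    using eventually_happens'[OF sequentially_bot] by blast
  \<comment> \<open>A gain of 1/2 per \<open>Suc m\<close> steps, expressed as a rate per
    step.\<close>
  define r where "r = root (Suc m) (1 / 2)"
  have r: "0 < r" "r < 1" "r ^ Suc m = 1 / 2"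
    by (auto simp: r_def simp del: power_Suc)
  have "((\<lambda>g. B * c * b m g) \<longlongrightarrow> B * c * (q * (real (saw_count TYPE('d) m) * z ^ m))) at_top"
    by (intro tendsto_mult tendsto_const b_lim)
  moreover have "B * c * (q * (real (saw_count TYPE('d) m) * z ^ m)) < 1 / 2"
    using m by (simp add: z q_def mult_ac)
  ultimately have ev1: "\<forall>\<^sub>F g in at_top. B * c * b m g < 1 / 2"
    by (rule order_tendstoD)
  \<comment> \<open>The added 1 is slack that turns convergence into a bound for all large
    g.\<close>
  define D where "D = (\<Sum>i<Suc m. q * (real (saw_count TYPE('d) i) * z ^ i) / r ^ i) + 1"
  have "((\<lambda>g. \<Sum>i<Suc m. b i g / r ^ i) \<longlongrightarrow>
      (\<Sum>i<Suc m. q * (real (saw_count TYPE('d) i) * z ^ i) / r ^ i)) at_top"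
    using r by (intro tendsto_sum tendsto_divide b_lim tendsto_const) auto
  then have ev2: "\<forall>\<^sub>F g in at_top. (\<Sum>i<Suc m. b i g / r ^ i) < D"
    by (rule order_tendstoD) (simp add: D_def)
  have bound: "\<forall>\<^sub>F g in at_top. \<forall>n. norm (a n g) \<le> D * r ^ n"
    using ev1 ev2 eventually_gt_at_top[of 0]
  proof eventually_elim
    case (elim g)
    have "b (n + Suc m) g \<le> r ^ Suc m * b n g" for n
    proof -
      have "b (n + Suc m) g \<le> B * c * b m g * b n g"
        using elim by (intro block) auto
      also have "\<dots> \<le> 1 / 2 * b n g"
        using elim by (intro mult_right_mono b_nonneg) auto
      finally show ?thesis by (simp only: r)
    qed
    then have "b n g \<le> (\<Sum>i<Suc m. b i g / r ^ i) * r ^ n" for n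
      using r b_nonneg by (intro geometric_bound) auto
    also have "(\<Sum>i<Suc m. b i g / r ^ i) * r ^ n \<le> D * r ^ n" for n
      using elim r by (intro mult_right_mono) auto
    finally show ?case
      using a_nonneg order_trans[OF a_le_b] by simp
  qed
  have "\<forall>\<^sub>F (n, g) in at_top \<times>\<^sub>F at_top. norm (a n g) \<le> D * r ^ n"
    by (rule eventually_mono[OF eventually_prodI[OF always_eventually bound, of "\<lambda>_. True"]]) auto
  moreover have "summable (\<lambda>n. D * r ^ n)"
    using r by (intro summable_mult summable_geometric) auto
  ultimately have tannery: "\<forall>\<^sub>F g in at_top. summable (\<lambda>n. norm (a n g))"
     "((\<lambda>g. \<Sum>n. a n g) \<longlongrightarrow> (\<Sum>n. q * (real (saw_count_to n x) * z ^ n))) at_top"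
     "summable (\<lambda>n. norm (q * (real (saw_count_to n x) * z ^ n)))"
    using tannerys_theorem[OF a_lim] by auto
  \<comment> \<open>For q = 0 the summability of the scaled series says nothing about the unscaled
    one, but then both sides are 0.\<close>
  have "(\<Sum>n. q * (real (saw_count_to n x) * z ^ n)) = q * saw_two_point z x"
  proof (cases "q = 0")
    case False
    then have "summable (\<lambda>n. real (saw_count_to n x) * z ^ n)"
      using summable_norm_cancel[OF tannery(3)] summable_cmult_iff by blast
    then show ?thesis by (simp add: saw_two_point_def suminf_mult)
  qed simp
  then have "((\<lambda>g. ennreal (\<Sum>n. a n g)) \<longlongrightarrow> ennreal (q * saw_two_point z x)) at_top"
    using tendsto_ennrealI[OF tannery(2)] by simp
  moreover have "\<forall>\<^sub>F g in at_top. ennreal (\<Sum>n. a n g) = (\<Sum>n. ennreal (c ^ n) *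
              (\<Sum>ys\<in>{ys \<in> walks n. last ys = x}. walk_weight g (\<rho> g) (\<lambda>_. 0) ys))"
    using tannery(1) eventually_gt_at_top[of 0]
  proof eventually_elim
    case (elim g)
    have "(\<Sum>n. ennreal (a n g)) = ennreal (\<Sum>n. a n g)"
      by (rule suminf_ennreal2[OF a_nonneg summable_norm_cancel[OF elim(1)]])
    moreover have "ennreal (a n g) = ennreal (c ^ n) *
              (\<Sum>ys\<in>{ys \<in> walks n. last ys = x}. walk_weight g (\<rho> g) (\<lambda>_. 0) ys)" for n
      using elim c w_nonneg W by (simp add: a_def ennreal_mult' sum_nonneg)
    ultimately show ?case by simp
  qed
  ultimately show ?thesis
    unfolding q_def by (rule Lim_transform_eventually)
qed

section \<open>The functional of the path of a killed walk\<close>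

text \<open>The integrand of \<open>walk_weight\<close> for one fixed sequence of holding times. The
  counter \<open>k\<close> replaces a shift of the sequence and matches the index set of the product
  measure.\<close>

fun path_weight :: "real \<Rightarrow> real \<Rightarrow> ('a \<Rightarrow> real) \<Rightarrow> 'a list \<Rightarrow> nat \<Rightarrow> (nat \<Rightarrow> real) \<Rightarrow> real" where
  "path_weight g \<rho> l [] k s = 1"
| "path_weight g \<rho> l (v # vs) k s =
     site_weight g \<rho> (l v) (s k) * path_weight g \<rho> (l(v := l v + s k)) vs (Suc k) s"

lemma path_weight_cong:
  "(\<And>i. k \<le> i \<Longrightarrow> s i = s' i) \<Longrightarrow> path_weight g \<rho> l ys k s = path_weight g \<rho> l ys k s'"
proof (induction ys arbitrary: l k)
  case (Cons v vs)
  then show ?case using Cons.IH[of "Suc k"] by (simp del: fun_upd_apply)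
qed simp

lemma path_weight_measurable:
  assumes "\<And>v. (\<lambda>x. l x v) \<in> borel_measurable N"
    and "\<And>i. k \<le> i \<Longrightarrow> i < k + length ys \<Longrightarrow> (\<lambda>x. s x i) \<in> borel_measurable N"
  shows "(\<lambda>x. path_weight g \<rho> (l x) ys k (s x)) \<in> borel_measurable N"
  using assms
proof (induction ys arbitrary: l k)
  case (Cons v vs)
  have [measurable]: "(\<lambda>x. s x k) \<in> borel_measurable N" "\<And>v. (\<lambda>x. l x v) \<in> borel_measurable N"
    using Cons.prems by auto
  have [measurable]: "(\<lambda>x. path_weight g \<rho> ((l x)(v := l x v + s x k)) vs (Suc k) (s x)) \<in> borel_measurable N"
    by (rule Cons.IH) (use Cons.prems(2) in \<open>auto simp: fun_upd_def\<close>)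
  show ?case by simp
qed simp

text \<open>The increments s^2 + 2 a s telescope over the visits to each site, which recovers the
  square of its total local time.\<close>

lemma path_weight_eq:
  assumes "finite V" "set ys \<subseteq> V"
  shows "path_weight g \<rho> l ys k s =
    exp (- g * (\<Sum>v\<in>V. (l v + (\<Sum>i<length ys. of_bool (ys ! i = v) * s (k + i)))\<^sup>2 - (l v)\<^sup>2)
         + \<rho> * (\<Sum>i<length ys. s (k + i)))"
  using assms(2)
proof (induction ys arbitrary: l k)
  case (Cons u us)
  let ?T = "\<lambda>v. \<Sum>i<length us. of_bool (us ! i = v) * s (Suc k + i)"
  let ?l = "l(u := l u + s k)"
  have T: "(\<Sum>i<length (u # us). of_bool ((u # us) ! i = v) * s (k + i)) = of_bool (u = v) * s k + ?T v" for v
    unfolding length_Cons by (subst sum.lessThan_Suc_shift) simp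
  have "(\<Sum>v\<in>V. (l v + (of_bool (u = v) * s k + ?T v))\<^sup>2 - (l v)\<^sup>2)
     = (\<Sum>v\<in>V. ((?l v + ?T v)\<^sup>2 - (?l v)\<^sup>2) + (if v = u then (s k)\<^sup>2 + 2 * l u * s k else 0))"
    by (intro sum.cong) (auto simp: power2_eq_square algebra_simps)
  also have "\<dots> = (\<Sum>v\<in>V. (?l v + ?T v)\<^sup>2 - (?l v)\<^sup>2) + ((s k)\<^sup>2 + 2 * l u * s k)"
    using Cons.prems assms(1) by (simp add: sum.distrib)
  finally have 1: "(\<Sum>v\<in>V. (l v + (\<Sum>i<length (u # us). of_bool ((u # us) ! i = v) * s (k + i)))\<^sup>2 - (l v)\<^sup>2)
     = (\<Sum>v\<in>V. (?l v + ?T v)\<^sup>2 - (?l v)\<^sup>2) + ((s k)\<^sup>2 + 2 * l u * s k)"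
    unfolding T .
  have 2: "(\<Sum>i<length (u # us). s (k + i)) = s k + (\<Sum>i<length us. s (Suc k + i))"
    unfolding length_Cons by (subst sum.lessThan_Suc_shift) simp
  have "path_weight g \<rho> l (u # us) k s = site_weight g \<rho> (l u) (s k) * path_weight g \<rho> ?l us (Suc k) s"
    by simp
  also have "\<dots> = site_weight g \<rho> (l u) (s k) *
      exp (- g * (\<Sum>v\<in>V. (?l v + ?T v)\<^sup>2 - (?l v)\<^sup>2) + \<rho> * (\<Sum>i<length us. s (Suc k + i)))"
    using Cons.prems by (subst Cons.IH) auto
  finally show ?case
    unfolding 1 2 site_weight_def exp_add[symmetric] by (simp add: algebra_simps)
qed simp

text \<open>Tonelli, integrating out the first holding time last: the inner integral over the later
  ones is the weight of the tail with an updated field.\<close>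

lemma nn_integral_path_weight:
  "(\<integral>\<^sup>+ s. ennreal (path_weight g \<rho> l ys k s) \<partial>Pi\<^sub>M {k..<k + length ys} (\<lambda>_. Exp1))
     = walk_weight g \<rho> l ys"
proof (induction ys arbitrary: l k)
  case Nil
  show ?case by (simp add: PiM_empty nn_integral_count_space_finite)
next
  case (Cons v vs)
  interpret product_sigma_finite "\<lambda>_. Exp1" ..
  let ?I = "{Suc k..<Suc k + length vs}"
  have ins: "{k..<k + length (v # vs)} = insert k ?I" by auto
  have comp: "(\<lambda>x. x i) \<in> borel_measurable (Pi\<^sub>M J (\<lambda>_. Exp1))" if "i \<in> J" for i and J :: "nat set"
    using measurable_component_singleton[OF that, of "\<lambda>_. Exp1"] by (simp cong: measurable_cong_sets)
  have meas: "(\<lambda>s. ennreal (path_weight g \<rho> l (v # vs) k s)) \<in> borel_measurable (Pi\<^sub>M (insert k ?I) (\<lambda>_. Exp1))"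
    by (intro measurable_compose[OF _ measurable_ennreal] path_weight_measurable comp) auto
  have "(\<integral>\<^sup>+ s. ennreal (path_weight g \<rho> l (v # vs) k s) \<partial>Pi\<^sub>M {k..<k + length (v # vs)} (\<lambda>_. Exp1))
     = (\<integral>\<^sup>+ y. (\<integral>\<^sup>+ s. ennreal (path_weight g \<rho> l (v # vs) k (s(k := y))) \<partial>Pi\<^sub>M ?I (\<lambda>_. Exp1)) \<partial>Exp1)"
    unfolding ins by (rule product_nn_integral_insert_rev[OF _ _ meas]) auto
  also have "\<dots> = (\<integral>\<^sup>+ y. ennreal (site_weight g \<rho> (l v) y) * walk_weight g \<rho> (l(v := l v + y)) vs \<partial>Exp1)"
  proof (intro nn_integral_cong)
    fix y
    have eq: "path_weight g \<rho> l (v # vs) k (s(k := y))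
       = site_weight g \<rho> (l v) y * path_weight g \<rho> (l(v := l v + y)) vs (Suc k) s" for s
      using path_weight_cong[of "Suc k" "s(k := y)" s g \<rho> "l(v := l v + y)" vs] by simp
    have "(\<integral>\<^sup>+ s. ennreal (path_weight g \<rho> l (v # vs) k (s(k := y))) \<partial>Pi\<^sub>M ?I (\<lambda>_. Exp1))
      = (\<integral>\<^sup>+ s. ennreal (site_weight g \<rho> (l v) y)
           * ennreal (path_weight g \<rho> (l(v := l v + y)) vs (Suc k) s) \<partial>Pi\<^sub>M ?I (\<lambda>_. Exp1))"
      by (simp only: eq ennreal_mult'[OF less_imp_le[OF site_weight_pos]])
    also have "\<dots> = ennreal (site_weight g \<rho> (l v) y) * walk_weight g \<rho> (l(v := l v + y)) vs"
      unfolding Cons.IH[of "Suc k" "l(v := l v + y)", symmetric]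
      by (intro nn_integral_cmult measurable_compose[OF _ measurable_ennreal]
          path_weight_measurable comp) auto
    finally show "(\<integral>\<^sup>+ s. ennreal (path_weight g \<rho> l (v # vs) k (s(k := y))) \<partial>Pi\<^sub>M ?I (\<lambda>_. Exp1))
      = ennreal (site_weight g \<rho> (l v) y) * walk_weight g \<rho> (l(v := l v + y)) vs" .
  qed
  finally show ?case by simp
qed

text \<open>What the argument needs of a single sample path, free of probability. Strictly positive
  holding times make all intervals nonempty.\<close>

locale killed_path =
  fixes \<xi> :: "real \<Rightarrow> 'a option" and y :: "nat \<Rightarrow> 'a option" and s :: "nat \<Rightarrow> real" and ys :: "'a list"
  assumes ne: "ys \<noteq> []"
    and y_Some: "\<And>i. i < length ys \<Longrightarrow> y i = Some (ys ! i)"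
    and y_None: "y (length ys) = None"
    and s_pos: "\<And>i. 0 < s i"
    and path: "\<And>n t. (\<Sum>i<n. s i) \<le> t \<Longrightarrow> t < (\<Sum>i<Suc n. s i) \<Longrightarrow> \<xi> t = y n"
begin

abbreviation "T n \<equiv> (\<Sum>i<n. s i)"

lemma T_mono: "m \<le> n \<Longrightarrow> T m \<le> T n"
  using s_pos by (intro sum_mono2) (auto intro: less_imp_le)

lemma before_killing:
  assumes "0 \<le> t" "t < T n"
  obtains k where "k < n" "T k \<le> t" "t < T (Suc k)"
  using assms
proof (induction n arbitrary: thesis)
  case (Suc n)
  show ?case
  proof (cases "t < T n")
    case True
    show ?thesis
      by (rule Suc.IH[OF _ Suc.prems(2) True]) (rule Suc.prems(1)[OF less_SucI])
  next
    case False
    then show ?thesis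
      using Suc.prems(1)[of n] Suc.prems(3) by simp
  qed
qed simp

text \<open>The intervals are closed on the left, so the infimum is attained.\<close>

lemma killing_time_eq: "killing_time \<xi> = T (length ys)"
  unfolding killing_time_def
proof (rule cInf_eq_minimum)
  show "T (length ys) \<in> {t. 0 \<le> t \<and> \<xi> t = None}"
    using path[of "length ys" "T (length ys)"] y_None s_pos T_mono[of 0 "length ys"] by simp
next
  fix t assume t: "t \<in> {t. 0 \<le> t \<and> \<xi> t = None}"
  show "T (length ys) \<le> t"
  proof (rule ccontr)
    assume "\<not> T (length ys) \<le> t"
    then obtain k where "k < length ys" "T k \<le> t" "t < T (Suc k)"
      using t before_killing[of t "length ys"] by auto
    then show False using path[of k t] y_Some[of k] t by simp
  qed
qed

text \<open>The last holding interval is nonempty and ends at the killing time, so it determines the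
  left limit; the limit is unique since the filter \<open>at_left\<close> is nontrivial.\<close>

lemma last_site_iff: "last_site \<xi> x \<longleftrightarrow> last ys = x"
proof -
  define n where "n = length ys - 1"
  have n: "length ys = Suc n" using ne by (simp add: n_def)
  have "T n < T (Suc n)" using s_pos by simp
  then have ev: "\<forall>\<^sub>F t in at_left (killing_time \<xi>). \<xi> t = Some (last ys)"
    unfolding killing_time_eq n
    by (rule eventually_mono[OF eventually_at_left_real])
       (use path[of n] y_Some[of n] ne n in \<open>auto simp: last_conv_nth\<close>)
  show ?thesis
  proof
    assume "last_site \<xi> x"
    with ev have "\<forall>\<^sub>F t in at_left (killing_time \<xi>). last ys = x"
      unfolding last_site_def by eventually_elim auto
    then show "last ys = x" by (simp add: trivial_limit_at_left_real)
  qed (use ev in \<open>auto simp: last_site_def\<close>)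
qed

lemma local_time_eq: "local_time \<xi> v = (\<Sum>i<length ys. of_bool (ys ! i = v) * s i)"
proof -
  have "indicator {0..killing_time \<xi>} t *\<^sub>R of_bool (\<xi> t = Some v)
      = (\<Sum>i<length ys. of_bool (ys ! i = v) * (indicator {T i..<T (Suc i)} t :: real))" for t
  proof (cases "0 \<le> t \<and> t < T (length ys)")
    case True
    then obtain k where k: "k < length ys" "T k \<le> t" "t < T (Suc k)"
      using before_killing by blast
    have "indicator {T i..<T (Suc i)} t = (of_bool (i = k) :: real)" for i
      using k T_mono[of "Suc i" k] T_mono[of "Suc k" i]
      by (cases i k rule: linorder_cases) (auto simp del: sum.lessThan_Suc)
    then have "(\<Sum>i<length ys. of_bool (ys ! i = v) * (indicator {T i..<T (Suc i)} t :: real))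
       = (\<Sum>i<length ys. if i = k then of_bool (ys ! i = v) else 0)"
      by (intro sum.cong) auto
    then show ?thesis
      using True k path[of k t] y_Some[of k] by (simp add: killing_time_eq)
  next
    case False
    have "indicator {T i..<T (Suc i)} t = (0 :: real)" if "i < length ys" for i
      using False T_mono[of 0 i] T_mono[of "Suc i" "length ys"] that
      by (auto simp del: sum.lessThan_Suc simp: indicator_def)
    moreover have "indicator {0..killing_time \<xi>} t *\<^sub>R of_bool (\<xi> t = Some v) = (0 :: real)"
    \<comment> \<open>The closed right end of the integration interval contributes nothing: the path
      is already in the cemetery.\<close>
    proof (cases "t = T (length ys)")
      case True
      then show ?thesis
        using path[of "length ys" t] y_None s_pos[of "length ys"] by simp
    qed (use False in \<open>auto simp: killing_time_eq indicator_def\<close>)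
    ultimately show ?thesis by simp
  qed
  then have "local_time \<xi> v =
      (\<integral>t. (\<Sum>i<length ys. of_bool (ys ! i = v) * (indicator {T i..<T (Suc i)} t :: real)) \<partial>lborel)"
    by (simp add: local_time_def set_lebesgue_integral_def)
  also have "\<dots> = (\<Sum>i<length ys. of_bool (ys ! i = v) * (\<integral>t. indicator {T i..<T (Suc i)} t \<partial>lborel))"
    using s_pos by (subst Bochner_Integration.integral_sum)
      (auto intro!: integrable_real_indicator simp: less_imp_le)
  also have "\<dots> = (\<Sum>i<length ys. of_bool (ys ! i = v) * s i)"
    using s_pos by (intro sum.cong) (auto simp: less_imp_le)
  finally show ?thesis .
qed

lemma functional_eq:
  "exp (- g * (\<Sum>\<^sub>\<infinity>v\<in>UNIV. (local_time \<xi> v)\<^sup>2) + \<rho> * killing_time \<xi>)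
     = path_weight g \<rho> (\<lambda>_. 0) ys 0 s"
proof -
  have "(\<Sum>\<^sub>\<infinity>v\<in>UNIV. (local_time \<xi> v)\<^sup>2) = (\<Sum>\<^sub>\<infinity>v\<in>set ys. (local_time \<xi> v)\<^sup>2)"
  proof (rule infsum_cong_neutral)
    fix v assume "v \<in> UNIV - set ys"
    then have "ys ! i \<noteq> v" if "i < length ys" for i using that by auto
    then show "(local_time \<xi> v)\<^sup>2 = 0" by (simp add: local_time_eq)
  qed auto
  then show ?thesis
    by (subst path_weight_eq[of "set ys"]) (simp_all add: local_time_eq killing_time_eq)
qed

end

section \<open>The law of the killed walk\<close>

text \<open>Independence says that restricting M to an event of \<open>U\<close> rescales the law of
  \<open>V\<close> by the probability of that event. Integrating \<open>F\<close> against both sides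
  gives the product.\<close>

lemma (in prob_space) nn_integral_indep_indicator:
  assumes indep: "indep_set (sets (vimage_algebra (space M) U S)) (sets (vimage_algebra (space M) V T))"
    and U: "U \<in> M \<rightarrow>\<^sub>M S" and V: "V \<in> M \<rightarrow>\<^sub>M T" and A: "A \<in> sets S"
    and F: "F \<in> borel_measurable T"
  shows "(\<integral>\<^sup>+ \<omega>. indicator (U -` A \<inter> space M) \<omega> * F (V \<omega>) \<partial>M)
     = emeasure M (U -` A \<inter> space M) * (\<integral>\<^sup>+ \<omega>. F (V \<omega>) \<partial>M)"
proof -
  let ?E = "U -` A \<inter> space M"
  note [measurable] = V F
  have [measurable]: "?E \<in> sets M" using U A by (rule measurable_sets)
  have eq: "distr (density M (indicator ?E)) T V = scale_measure (emeasure M ?E) (distr M T V)"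
  proof (rule measure_eqI)
    fix B assume "B \<in> sets (distr (density M (indicator ?E)) T V)"
    then have B: "B \<in> sets T" by simp
    then have [measurable]: "V -` B \<inter> space M \<in> sets M" using V by (rule measurable_sets[rotated])
    have "emeasure (distr (density M (indicator ?E)) T V) B
        = emeasure (density M (indicator ?E)) (V -` B \<inter> space M)"
      using B by (subst emeasure_distr) auto
    also have "\<dots> = emeasure M (?E \<inter> (V -` B \<inter> space M))"
      by (subst emeasure_density)
         (auto simp: indicator_inter_arith[symmetric] nn_integral_indicator simp del: nn_integral_indicator')
    also have "\<dots> = emeasure M ?E * emeasure M (V -` B \<inter> space M)"
    proof -
      have "prob (?E \<inter> (V -` B \<inter> space M)) = prob ?E * prob (V -` B \<inter> space M)"
        using in_vimage_algebra[OF A] in_vimage_algebra[OF B] by (intro indep_setD[OF indep]) auto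
      then show ?thesis by (simp add: emeasure_eq_measure ennreal_mult')
    qed
    finally show "emeasure (distr (density M (indicator ?E)) T V) B
       = emeasure (scale_measure (emeasure M ?E) (distr M T V)) B"
      using B by (simp add: emeasure_distr)
  qed simp
  have "(\<integral>\<^sup>+ \<omega>. indicator ?E \<omega> * F (V \<omega>) \<partial>M) = (\<integral>\<^sup>+ \<omega>. F (V \<omega>) \<partial>density M (indicator ?E))"
    by (subst nn_integral_density) auto
  also have "\<dots> = (\<integral>\<^sup>+ t. F t \<partial>distr (density M (indicator ?E)) T V)"
    by (subst nn_integral_distr) auto
  also have "\<dots> = emeasure M ?E * (\<integral>\<^sup>+ \<omega>. F (V \<omega>) \<partial>M)"
    unfolding eq by (simp add: nn_integral_scale_measure nn_integral_distr)
  finally show ?thesis .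
qed

lemma (in prob_space) nn_integral_path_weight_holding_times:
  assumes \<sigma>: "holding_times M \<sigma>" and ne: "ys \<noteq> []"
  shows "(\<integral>\<^sup>+ \<omega>. ennreal (path_weight g \<rho> (\<lambda>_. 0) ys 0 (\<lambda>n. \<sigma> n \<omega>)) \<partial>M) = walk_weight g \<rho> (\<lambda>_. 0) ys"
proof -
  let ?I = "{0..<0 + length ys}"
  have dist: "\<And>n. distributed M lborel (\<sigma> n) (exponential_density 1)"
    and ind: "indep_vars (\<lambda>_. borel) \<sigma> UNIV"
    using \<sigma> by (auto simp: holding_times_def)
  have rv: "random_variable borel (\<sigma> n)" for n
    using distributed_measurable[OF dist[of n]] by simp
  have "distr M borel (\<sigma> n) = Exp1" for n
    using distributed_distr_eq_density[OF dist[of n]] by (simp cong: distr_cong)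
  then have distr: "distr M (Pi\<^sub>M ?I (\<lambda>_. borel)) (\<lambda>\<omega>. \<lambda>i\<in>?I. \<sigma> i \<omega>) = Pi\<^sub>M ?I (\<lambda>_. Exp1)"
    using indep_vars_iff_distr_eq_PiM[where I = ?I and M' = "\<lambda>_. borel" and X = \<sigma>]
      indep_vars_subset[OF ind, of ?I] rv ne by simp
  have meas: "(\<lambda>s. ennreal (path_weight g \<rho> (\<lambda>_. 0) ys 0 s)) \<in> borel_measurable (Pi\<^sub>M ?I (\<lambda>_. borel))"
    by (intro measurable_compose[OF _ measurable_ennreal] path_weight_measurable
        measurable_component_singleton) auto
  have restrict: "(\<lambda>\<omega>. \<lambda>i\<in>?I. \<sigma> i \<omega>) \<in> M \<rightarrow>\<^sub>M Pi\<^sub>M ?I (\<lambda>_. borel)"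
    using rv by measurable
  have cong: "path_weight g \<rho> l zs k (\<lambda>i\<in>{0..<n}. s i) = path_weight g \<rho> l zs k s"
    if "k + length zs \<le> n" for l k n s and zs :: "'b list"
    using that by (induction zs arbitrary: l k) auto
  have "walk_weight g \<rho> (\<lambda>_. 0) ys = (\<integral>\<^sup>+ s. ennreal (path_weight g \<rho> (\<lambda>_. 0) ys 0 s) \<partial>Pi\<^sub>M ?I (\<lambda>_. Exp1))"
    by (rule nn_integral_path_weight[symmetric])
  also have "\<dots> = (\<integral>\<^sup>+ \<omega>. ennreal (path_weight g \<rho> (\<lambda>_. 0) ys 0 (\<lambda>i\<in>?I. \<sigma> i \<omega>)) \<partial>M)"
    unfolding distr[symmetric] by (rule nn_integral_distr[OF restrict]) (use meas in simp)
  also have "\<dots> = (\<integral>\<^sup>+ \<omega>. ennreal (path_weight g \<rho> (\<lambda>_. 0) ys 0 (\<lambda>n. \<sigma> n \<omega>)) \<partial>M)"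
    by (simp add: cong)
  finally show ?thesis by simp
qed

text \<open>Compared with the chain up to the index \<open>length ys\<close> inclusive, so that the
  jump to the cemetery is part of the event.\<close>

definition killed_seq :: "'a list \<Rightarrow> nat \<Rightarrow> 'a option" where
  "killed_seq ys i = (if i < length ys then Some (ys ! i) else None)"

text \<open>The first equation feeds the expansion over walks. The second isolates the killing
  factor, which is the same at every site, and drives the decay of the survival probability.\<close>

lemma (in prob_space) prob_killed_seq:
  fixes ys :: "(int ^ 'd::finite) list"
  assumes Y: "jump_chain \<delta> M Y" and ne: "ys \<noteq> []"
  shows "prob {\<omega> \<in> space M. \<forall>i\<le>length ys. Y i \<omega> = killed_seq ys i}
     = of_bool (ys \<in> walks (length ys - 1)) * ((1 - \<delta>) / (2 * real CARD('d))) ^ (length ys - 1) * \<delta>"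
    and "prob {\<omega> \<in> space M. \<forall>i\<le>length ys. Y i \<omega> = killed_seq ys i}
     = \<delta> * prob {\<omega> \<in> space M. \<forall>i\<le>length ys - 1. Y i \<omega> = killed_seq ys i}"
proof -
  define c where "c = (1 - \<delta>) / (2 * real CARD('d))"
  define n where "n = length ys - 1"
  have n: "length ys = Suc n" using ne by (simp add: n_def)
  have start: "killed_seq ys 0 = Some 0 \<longleftrightarrow> hd ys = 0"
    using ne by (simp add: killed_seq_def hd_conv_nth)
  have kill: "jump_prob \<delta> (killed_seq ys n) (killed_seq ys (Suc n)) = \<delta>"
    using n by (simp add: killed_seq_def jump_prob_def)
  have prob: "prob {\<omega> \<in> space M. \<forall>i\<le>m. Y i \<omega> = killed_seq ys i}
     = (if hd ys = 0 then \<Prod>i<m. jump_prob \<delta> (killed_seq ys i) (killed_seq ys (Suc i)) else 0)" for m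
    using Y unfolding jump_chain_def start[symmetric] by blast
  then show "prob {\<omega> \<in> space M. \<forall>i\<le>length ys. Y i \<omega> = killed_seq ys i}
     = \<delta> * prob {\<omega> \<in> space M. \<forall>i\<le>length ys - 1. Y i \<omega> = killed_seq ys i}"
    unfolding n using kill by simp
  have "(\<Prod>i<n. jump_prob \<delta> (killed_seq ys i) (killed_seq ys (Suc i)))
      = (\<Prod>i<n. of_bool (adjacent (ys ! i) (ys ! Suc i)) * c)"
    by (intro prod.cong) (auto simp: n killed_seq_def jump_prob_def c_def)
  also have "\<dots> = of_bool (\<forall>i<n. adjacent (ys ! i) (ys ! Suc i)) * c ^ n"
    by (cases "\<forall>i<n. adjacent (ys ! i) (ys ! Suc i)") (auto simp: prod.distrib intro!: prod_zero)
  finally show "prob {\<omega> \<in> space M. \<forall>i\<le>length ys. Y i \<omega> = killed_seq ys i}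
     = of_bool (ys \<in> walks (length ys - 1)) * ((1 - \<delta>) / (2 * real CARD('d))) ^ (length ys - 1) * \<delta>"
    unfolding prob n using kill n by (simp add: walks_def c_def)
qed

text \<open>Survival up to n splits into countably many cylinders, one for each list of n + 1 sites,
  and in each of them the next jump kills with probability \<delta>. Passing through the killed part
  gives the factor 1 - \<delta> per step and replaces a sum over neighbours.\<close>

lemma (in prob_space) AE_killed:
  fixes Y :: "nat \<Rightarrow> 'a \<Rightarrow> (int ^ 'd::finite) option"
  assumes \<delta>: "0 < \<delta>" "\<delta> < 1" and Y: "jump_chain \<delta> M Y"
  shows "AE \<omega> in M. \<exists>n. Y n \<omega> = None"
proof -
  have [measurable]: "Y n \<in> M \<rightarrow>\<^sub>M count_space UNIV" for n
    using Y by (simp add: jump_chain_def)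
  define alive where "alive = (\<lambda>n. {\<omega> \<in> space M. \<forall>i\<le>n. Y i \<omega> \<noteq> None})"
  define Z where "Z = (\<lambda>m ys. {\<omega> \<in> space M. \<forall>i\<le>m. Y i \<omega> = killed_seq ys i})"
  have [measurable]: "alive n \<in> sets M" for n unfolding alive_def by measurable
  have [measurable]: "Z m ys \<in> sets M" for m ys unfolding Z_def by measurable
  let ?L = "\<lambda>n. {ys :: (int ^ 'd) list. length ys = Suc n}"
  have disj: "disjoint_family_on (Z m) (?L n)" if "n \<le> m" for n m
    unfolding disjoint_family_on_def
  proof (intro ballI impI)
    fix ys zs assume ys: "ys \<in> ?L n" "zs \<in> ?L n" "ys \<noteq> zs"
    then obtain i where "i \<le> n" "ys ! i \<noteq> zs ! i"
      by (metis (mono_tags) mem_Collect_eq less_Suc_eq_le nth_equalityI)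
    then have "killed_seq ys i \<noteq> killed_seq zs i" "i \<le> m"
      using ys that by (auto simp: killed_seq_def)
    then show "Z m ys \<inter> Z m zs = {}" by (auto simp: Z_def)
  qed
  have the: "\<exists>ys\<in>?L n. \<forall>i\<le>n. Y i \<omega> = killed_seq ys i" if "\<omega> \<in> alive n" for n \<omega>
    using that
    by (intro bexI[of _ "map (\<lambda>i. the (Y i \<omega>)) [0..<Suc n]"])
       (auto simp: alive_def killed_seq_def less_Suc_eq_le simp del: upt_Suc)
  have alive: "alive n = (\<Union>ys\<in>?L n. Z n ys)" for n
    using the[of _ n] by (auto simp: Z_def alive_def killed_seq_def)
  have dies: "alive n - alive (Suc n) = (\<Union>ys\<in>?L n. Z (Suc n) ys)" for n
  proof (intro set_eqI iffI)
    fix \<omega> assume \<omega>: "\<omega> \<in> alive n - alive (Suc n)"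
    then have "Y (Suc n) \<omega> = None" "\<omega> \<in> space M" by (auto simp: alive_def le_Suc_eq)
    then show "\<omega> \<in> (\<Union>ys\<in>?L n. Z (Suc n) ys)"
      using the[of \<omega> n] \<omega> by (auto simp: Z_def le_Suc_eq killed_seq_def)
  next
    fix \<omega> assume "\<omega> \<in> (\<Union>ys\<in>?L n. Z (Suc n) ys)"
    then obtain ys where ys: "length ys = Suc n" "\<omega> \<in> Z (Suc n) ys" by auto
    then have "Y (Suc n) \<omega> = None" by (simp add: Z_def killed_seq_def)
    then show "\<omega> \<in> alive n - alive (Suc n)"
      using ys by (auto simp: Z_def alive_def killed_seq_def)
  qed
  have "emeasure M (alive n - alive (Suc n)) = ennreal \<delta> * emeasure M (alive n)" for n
  proof -
    have "emeasure M (Z (Suc n) ys) = ennreal \<delta> * emeasure M (Z n ys)" if "ys \<in> ?L n" for ys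
    proof -
      have "ys \<noteq> []" using that by auto
      from prob_killed_seq(2)[OF Y this] that \<delta> show ?thesis
        by (auto simp: Z_def emeasure_eq_measure ennreal_mult')
    qed
    then have "emeasure M (alive n - alive (Suc n)) = (\<integral>\<^sup>+ ys. ennreal \<delta> * emeasure M (Z n ys) \<partial>count_space (?L n))"
      unfolding dies using disj
      by (subst emeasure_UN_countable) (auto intro!: nn_integral_cong)
    then show ?thesis
      unfolding alive using disj
      by (subst (asm) nn_integral_cmult, simp) (subst emeasure_UN_countable, auto)
  qed
  then have "prob (alive n - alive (Suc n)) = \<delta> * prob (alive n)" for n
    using \<delta> by (simp add: emeasure_eq_measure ennreal_mult'[symmetric])
  moreover have "prob (alive n - alive (Suc n)) = prob (alive n) - prob (alive (Suc n))" for n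
    by (rule finite_measure_Diff) (auto simp: alive_def)
  ultimately have step: "prob (alive (Suc n)) = (1 - \<delta>) * prob (alive n)" for n
    by (simp add: algebra_simps)
  have bound: "prob (alive n) \<le> (1 - \<delta>) ^ n" for n
  proof (induction n)
    case (Suc n)
    then show ?case using \<delta> by (simp add: step mult_left_mono)
  qed simp
  have "prob {\<omega> \<in> space M. \<forall>i. Y i \<omega> \<noteq> None} \<le> (1 - \<delta>) ^ n" for n
    by (rule order_trans[OF finite_measure_mono bound]) (auto simp: alive_def)
  moreover have "(\<lambda>n. (1 - \<delta>) ^ n) \<longlonglongrightarrow> 0"
    using \<delta> by (intro LIMSEQ_realpow_zero) auto
  ultimately have "prob {\<omega> \<in> space M. \<forall>i. Y i \<omega> \<noteq> None} \<le> 0"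
    by (intro LIMSEQ_le_const) auto
  then have "prob {\<omega> \<in> space M. \<forall>i. Y i \<omega> \<noteq> None} = 0"
    by (simp add: measure_le_0_iff)
  then have "AE \<omega> in M. \<not> (\<forall>i. Y i \<omega> \<noteq> None)"
    by (subst AE_iff_measurable[OF _ refl]) (auto simp: emeasure_eq_measure)
  then show ?thesis by simp
qed

text \<open>Almost surely the sites visited before killing form one finite list, so the integrand is
  a sum over lists with at most one nonzero term. All terms are nonnegative, so sum and expectation
  exchange in [0, \<infinity>]; the prefactor 1/\<delta> cancels the probability of the final
  jump.\<close>

lemma ct_two_point_eq:
  fixes x :: "int ^ 'd::finite"
  assumes \<delta>: "0 < \<delta>" "\<delta> < 1" and X: "killed_walk \<delta> M X"
  shows "ct_two_point \<delta> M X g \<rho> x = (\<Sum>n. ennreal (((1 - \<delta>) / (2 * real CARD('d))) ^ n) *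
              (\<Sum>ys\<in>{ys \<in> walks n. last ys = x}. walk_weight g \<rho> (\<lambda>_. 0) ys))"
proof -
  define c where "c = (1 - \<delta>) / (2 * real CARD('d))"
  have c: "0 \<le> c" using \<delta> by (simp add: c_def)
  interpret prob_space M using X by (simp add: killed_walk_def)
  obtain Y \<sigma> where Y: "jump_chain \<delta> M Y" and \<sigma>: "holding_times M \<sigma>"
    and indep: "indep_set
          (sets (vimage_algebra (space M) (\<lambda>\<omega> n. Y n \<omega>) (Pi\<^sub>M UNIV (\<lambda>_. count_space UNIV))))
          (sets (vimage_algebra (space M) (\<lambda>\<omega> n. \<sigma> n \<omega>) (Pi\<^sub>M UNIV (\<lambda>_. borel))))"
    and path: "AE \<omega> in M. \<forall>n t. (\<Sum>i<n. \<sigma> i \<omega>) \<le> t \<and> t < (\<Sum>i<Suc n. \<sigma> i \<omega>) \<longrightarrow> X t \<omega> = Y n \<omega>"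
    using X unfolding killed_walk_def by blast
  have Ym: "Y n \<in> M \<rightarrow>\<^sub>M count_space UNIV" for n
    using Y by (simp add: jump_chain_def)
  have dist: "distributed M lborel (\<sigma> n) (exponential_density 1)" for n
    using \<sigma> by (simp add: holding_times_def)
  have \<sigma>m: "\<sigma> n \<in> borel_measurable M" for n
    using distributed_measurable[OF dist[of n]] by simp
  define A where "A = (\<lambda>ys. {\<omega> \<in> space M. \<forall>i\<le>length ys. Y i \<omega> = killed_seq ys i})"
  define w where "w = (\<lambda>(ys :: (int ^ 'd) list) \<omega>. path_weight g \<rho> (\<lambda>_. 0) ys 0 (\<lambda>n. \<sigma> n \<omega>))"
  let ?E = "{ys :: (int ^ 'd) list. ys \<noteq> [] \<and> last ys = x}"
  have start: "AE \<omega> in M. Y 0 \<omega> = Some 0"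
  proof -
    have "prob {\<omega> \<in> space M. \<forall>i\<le>0. Y i \<omega> = (\<lambda>_. Some 0) i} = 1"
      using Y unfolding jump_chain_def by (auto simp del: le_zero_eq)
    from AE_prob_1[OF this] show ?thesis by auto
  qed
  have pos: "AE \<omega> in M. \<forall>n. 0 < \<sigma> n \<omega>"
  proof (subst AE_all_countable, rule allI)
    fix n
    have "AE s in lborel. 0 < exponential_density 1 s \<longrightarrow> s \<noteq> 0 \<longrightarrow> (0::real) < s"
      by (auto simp: exponential_density_def)
    \<comment> \<open>The density is positive at 0 too, so this point is removed as a null
      set.\<close>
    moreover have "AE s in lborel. s \<noteq> (0::real)"
      by (rule AE_lborel_singleton)
    ultimately have "AE s in lborel. 0 < exponential_density 1 s \<longrightarrow> (0::real) < s"
      by eventually_elim auto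
    then show "AE \<omega> in M. 0 < \<sigma> n \<omega>"
      by (subst distributed_AE2[OF dist]) auto
  qed
  have pathwise: "AE \<omega> in M. (let \<xi> = (\<lambda>t. X t \<omega>) in
        ennreal (exp (- g * (\<Sum>\<^sub>\<infinity>v\<in>UNIV. (local_time \<xi> v)\<^sup>2) + \<rho> * killing_time \<xi>)
                 * of_bool (last_site \<xi> x)))
      = (\<integral>\<^sup>+ ys. indicator (A ys) \<omega> * ennreal (w ys \<omega>) \<partial>count_space ?E)"
    using AE_killed[OF \<delta> Y] start pos path AE_space
  proof eventually_elim
    case (elim \<omega>)
    define n where "n = (LEAST n. Y n \<omega> = None)"
    define ys where "ys = map (\<lambda>i. the (Y i \<omega>)) [0..<n]"
    have n: "Y n \<omega> = None"
      unfolding n_def using elim(1) by (rule LeastI_ex)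
    have less_n: "Y i \<omega> \<noteq> None" if "i < n" for i
      using that unfolding n_def by (rule not_less_Least)
    have "n \<noteq> 0" using n elim(2) by (intro notI) simp
    then have ne: "ys \<noteq> []" by (simp add: ys_def)
    interpret killed_path "\<lambda>t. X t \<omega>" "\<lambda>n. Y n \<omega>" "\<lambda>n. \<sigma> n \<omega>" ys
      using n less_n ne elim by unfold_locales (auto simp: ys_def)
    \<comment> \<open>A list records the first time in the cemetery and all sites before it, so the
      events \<open>A zs\<close> are disjoint.\<close>
    have in_A: "\<omega> \<in> A zs \<longleftrightarrow> zs = ys" for zs
    proof
      assume zs: "\<omega> \<in> A zs"
      then have "n = length zs"
        unfolding n_def by (intro Least_equality) (auto simp: A_def killed_seq_def not_less[symmetric])
      then show "zs = ys"
        using zs by (intro nth_equalityI) (auto simp: A_def killed_seq_def ys_def)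
    next
      assume "zs = ys"
      then show "\<omega> \<in> A zs"
        using elim n less_n by (auto simp: A_def killed_seq_def ys_def)
    qed
    have "(\<integral>\<^sup>+ ys. indicator (A ys) \<omega> * ennreal (w ys \<omega>) \<partial>count_space ?E)
       = (\<Sum>zs\<in>{ys} \<inter> ?E. indicator (A zs) \<omega> * ennreal (w zs \<omega>))"
      by (rule nn_integral_count_space') (auto simp: in_A)
    also have "\<dots> = ennreal (w ys \<omega> * of_bool (last ys = x))"
      using ne by (auto simp: in_A)
    finally show ?case
      unfolding Let_def functional_eq last_site_iff w_def by simp
  qed
  have wm: "(\<lambda>\<omega>. ennreal (w ys \<omega>)) \<in> borel_measurable M" for ys
    unfolding w_def
    by (intro measurable_compose[OF _ measurable_ennreal] path_weight_measurable \<sigma>m) auto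
  have Am: "A ys \<in> sets M" for ys
    unfolding A_def using Ym by measurable
  have walk: "(\<integral>\<^sup>+ \<omega>. indicator (A ys) \<omega> * ennreal (w ys \<omega>) \<partial>M)
     = (of_bool (ys \<in> walks (length ys - 1)) * ennreal (c ^ (length ys - 1) * \<delta>)) * walk_weight g \<rho> (\<lambda>_. 0) ys"
    if ne: "ys \<noteq> []" for ys
  proof -
    let ?S = "Pi\<^sub>M UNIV (\<lambda>_::nat. count_space UNIV :: (int ^ 'd) option measure)"
    let ?B = "{y \<in> space ?S. \<forall>i\<le>length ys. y i = killed_seq ys i}"
    have A: "A ys = (\<lambda>\<omega> n. Y n \<omega>) -` ?B \<inter> space M"
      by (auto simp: A_def space_PiM)
    have B: "?B \<in> sets ?S" by measurable
    have "(\<integral>\<^sup>+ \<omega>. indicator (A ys) \<omega> * ennreal (w ys \<omega>) \<partial>M)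
      = emeasure M (A ys) * (\<integral>\<^sup>+ \<omega>. ennreal (w ys \<omega>) \<partial>M)"
      unfolding A w_def
      by (rule nn_integral_indep_indicator[OF indep _ _ B,
            where F = "\<lambda>s. ennreal (path_weight g \<rho> (\<lambda>_. 0) ys 0 s)"])
         (intro measurable_PiM_single' Ym \<sigma>m measurable_compose[OF _ measurable_ennreal]
            path_weight_measurable measurable_component_singleton, auto)+
    also have "emeasure M (A ys) = of_bool (ys \<in> walks (length ys - 1)) * ennreal (c ^ (length ys - 1) * \<delta>)"
      using prob_killed_seq(1)[OF Y ne] by (simp add: emeasure_eq_measure A_def c_def)
    also have "(\<integral>\<^sup>+ \<omega>. ennreal (w ys \<omega>) \<partial>M) = walk_weight g \<rho> (\<lambda>_. 0) ys"
      unfolding w_def by (rule nn_integral_path_weight_holding_times[OF \<sigma> ne])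
    finally show ?thesis .
  qed
  have "ct_two_point \<delta> M X g \<rho> x
      = ennreal (1 / \<delta>) * (\<integral>\<^sup>+ \<omega>. (\<integral>\<^sup>+ ys. indicator (A ys) \<omega> * ennreal (w ys \<omega>) \<partial>count_space ?E) \<partial>M)"
    unfolding ct_two_point_def by (subst nn_integral_cong_AE[OF pathwise]) (rule refl)
  also have "\<dots> = ennreal (1 / \<delta>) * (\<integral>\<^sup>+ ys. (\<integral>\<^sup>+ \<omega>. indicator (A ys) \<omega> * ennreal (w ys \<omega>) \<partial>M) \<partial>count_space ?E)"
    using wm Am by (subst nn_integral_count_space_nn_integral) auto
  also have "(\<integral>\<^sup>+ ys. (\<integral>\<^sup>+ \<omega>. indicator (A ys) \<omega> * ennreal (w ys \<omega>) \<partial>M) \<partial>count_space ?E)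
     = (\<integral>\<^sup>+ ys. (\<Sum>n. ennreal (c ^ n * \<delta>) * (walk_weight g \<rho> (\<lambda>_. 0) ys * indicator (walks n) ys)) \<partial>count_space ?E)"
  proof (intro nn_integral_cong)
    fix ys assume "ys \<in> space (count_space ?E)"
    then have ne: "ys \<noteq> []" by simp
    \<comment> \<open>Each term is rewritten as a series whose only possible nonzero entry is at n =
      \<open>length ys - 1\<close>; exchanging sums then sorts the lists by number of steps.\<close>
    have "(\<Sum>n. ennreal (c ^ n * \<delta>) * (walk_weight g \<rho> (\<lambda>_. 0) ys * indicator (walks n) ys))
      = (\<Sum>n\<in>{length ys - 1}. ennreal (c ^ n * \<delta>) * (walk_weight g \<rho> (\<lambda>_. 0) ys * indicator (walks n) ys))"
      by (rule suminf_finite) (auto simp: walks_def split: split_indicator)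
    then show "(\<integral>\<^sup>+ \<omega>. indicator (A ys) \<omega> * ennreal (w ys \<omega>) \<partial>M)
      = (\<Sum>n. ennreal (c ^ n * \<delta>) * (walk_weight g \<rho> (\<lambda>_. 0) ys * indicator (walks n) ys))"
      unfolding walk[OF ne] by (simp add: mult_ac split: split_indicator)
  qed
  also have "\<dots> = (\<Sum>n. \<integral>\<^sup>+ ys. ennreal (c ^ n * \<delta>) * (walk_weight g \<rho> (\<lambda>_. 0) ys * indicator (walks n) ys) \<partial>count_space ?E)"
    by (rule nn_integral_suminf) simp
  also have "\<dots> = (\<Sum>n. ennreal (c ^ n * \<delta>) * (\<Sum>ys\<in>{ys \<in> walks n. last ys = x}. walk_weight g \<rho> (\<lambda>_. 0) ys))"
  proof (intro suminf_cong)
    fix n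
    have "(\<integral>\<^sup>+ ys. walk_weight g \<rho> (\<lambda>_. 0) ys * indicator (walks n) ys \<partial>count_space ?E)
      = (\<Sum>ys\<in>{ys \<in> walks n. last ys = x}. walk_weight g \<rho> (\<lambda>_. 0) ys * indicator (walks n) ys)"
      by (rule nn_integral_count_space') (auto dest: walks_ne)
    then show "(\<integral>\<^sup>+ ys. ennreal (c ^ n * \<delta>) * (walk_weight g \<rho> (\<lambda>_. 0) ys * indicator (walks n) ys) \<partial>count_space ?E)
      = ennreal (c ^ n * \<delta>) * (\<Sum>ys\<in>{ys \<in> walks n. last ys = x}. walk_weight g \<rho> (\<lambda>_. 0) ys)"
      by (simp add: nn_integral_cmult)
  qed
  also have "ennreal (1 / \<delta>) * \<dots> = (\<Sum>n. ennreal (1 / \<delta>) * (ennreal (c ^ n * \<delta>) *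
        (\<Sum>ys\<in>{ys \<in> walks n. last ys = x}. walk_weight g \<rho> (\<lambda>_. 0) ys)))"
    by (rule ennreal_suminf_cmult[symmetric])
  also have "\<dots> = (\<Sum>n. ennreal (c ^ n) * (\<Sum>ys\<in>{ys \<in> walks n. last ys = x}. walk_weight g \<rho> (\<lambda>_. 0) ys))"
  proof -
    have "ennreal (1 / \<delta>) * ennreal (c ^ n * \<delta>) = ennreal (c ^ n)" for n
      using \<delta> c by (subst ennreal_mult'[symmetric]) auto
    then show ?thesis by (simp add: mult.assoc[symmetric])
  qed
  finally show ?thesis by (simp only: c_def)
qed

theorem proposition3:
  fixes \<delta> z p :: real
    and x :: "int ^ 'd"
    and \<rho> :: "real \<Rightarrow> real"
    and M :: "'w measure"
    and X :: "real \<Rightarrow> 'w \<Rightarrow> (int ^ 'd) option"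
  assumes delta: "0 < \<delta>" "\<delta> < 1"
    and z: "0 \<le> z" "z < inverse (connective_constant TYPE('d))"
    and X: "killed_walk \<delta> M X"
    and p: "0 \<le> p" "z = (1 - \<delta>) / (2 * real CARD('d)) * p * sqrt pi"
    and rho: "((\<lambda>g. g powr (- 1 / 2) * exp ((alpha g (\<rho> g))\<^sup>2)) \<longlongrightarrow> p) at_top"
    and branch: "0 < p \<Longrightarrow> \<forall>\<^sub>F g in at_top. 0 \<le> alpha g (\<rho> g)"
  shows "((\<lambda>g. ct_two_point \<delta> M X g (\<rho> g) x) \<longlongrightarrow>
           ennreal (p * sqrt pi * saw_two_point z x)) at_top"
  unfolding ct_two_point_eq[OF delta X]
  by (rule walk_sum_tendsto[OF _ p(1) _ z(2) rho branch]) (use delta p in simp_all)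

end
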